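(* Let $p$ be an odd prime and let $n,m\ge1$. If a linear system over $\mathbb{Z}_p$ admits a solution in the group $E_n(p^m)$, then it admits a solution in $\mathbb{Z}_p$.
   Context: A linear system $(A,b)$ over $\mathbb{Z}_p$ consists of an $r\times c$ matrix $A$ over $\mathbb{Z}_p$ and $b\in\mathbb{Z}_p^r$. A solution in a group $G$ with a fixed central element $J_G$ of order $p$ is a tuple $T_1,\dots,T_c\in G$ with $T_j^p=1$ for all $j$; $T_jT_k=T_kT_j$ whenever $A_{ij}\neq0$ and $A_{ik}\neq0$ for some row $i$; and $\prod_jT_j^{A_{ij}}=J_G^{b_i}$ for all $1\le i\le r$. For $G=\mathbb{Z}_p$ one takes $J_G=1$, so this is an ordinary solution of $Ax=b$ over $\mathbb{Z}_p$. Let $\mathcal{H}=\mathbb{C}\mathbb{Z}_p$ be the vector space with orthonormal basis $\{b_a:a\in\mathbb{Z}_p\}$, let $T\subset SU(\mathcal{H})$ be the maximal torus of diagonal matrices, $T_{(p^m)}=\{t\in T:t^{p^m}=1\}$, and let $X$ be the permutation matrix $Xb_a=b_{a+1}$. Then $E_1(p^m)=\langle T_{(p^m)},X\rangle\subset SU(\mathcal{H})$, and $E_n(p^m)=E_1(p^m)\otimes\cdots\otimes E_1(p^m)$ ($n$ factors) is the group of operators $M_1\otimes\cdots\otimes M_n$ on $\mathcal{H}^{\otimes n}$ with $M_i\in E_1(p^m)$. The distinguished central element of $E_n(p^m)$ is $J=e^{2\pi i/p}\,\mathbb{1}$. *)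

theory Defs
  imports
    "HOL-Algebra.Elementary_Groups"
    "HOL-Algebra.Generated_Groups"
    "HOL-Algebra.Multiplicative_Group"
    "HOL-Number_Theory.Cong"
    "Jordan_Normal_Form.Schur_Decomposition"
    "Jordan_Normal_Form.Determinant"
begin

(* Z_p is integer_mod_group p: its elements are the integers 0, ..., p - 1. *)
definition linear_system :: "nat \<Rightarrow> nat \<Rightarrow> nat \<Rightarrow> int mat \<Rightarrow> int vec \<Rightarrow> bool" where
  "linear_system p r c A b \<longleftrightarrow>
     A \<in> carrier_mat r c \<and> b \<in> carrier_vec r \<and>
     (\<forall>i<r. \<forall>j<c. A $$ (i, j) \<in> carrier (integer_mod_group p)) \<and>
     (\<forall>i<r. b $ i \<in> carrier (integer_mod_group p))"

(* The product over a row is taken in increasing order of j.  The order is immaterial: factors with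
   A_ij = 0 are the identity and the remaining ones commute by the third clause.  The exponents are
   the representatives in 0, ..., p - 1, which is harmless because T_j^p = 1 and J^p = 1. *)
definition system_solution ::
  "nat \<Rightarrow> ('a, 'e) monoid_scheme \<Rightarrow> 'a \<Rightarrow> int mat \<Rightarrow> int vec \<Rightarrow> (nat \<Rightarrow> 'a) \<Rightarrow> bool" where
  "system_solution p G J A b T \<longleftrightarrow>
     (\<forall>j<dim_col A. T j \<in> carrier G) \<and>
     (\<forall>j<dim_col A. T j [^]\<^bsub>G\<^esub> p = \<one>\<^bsub>G\<^esub>) \<and>
     (\<forall>i<dim_row A. \<forall>j<dim_col A. \<forall>k<dim_col A.
        A $$ (i, j) \<noteq> 0 \<longrightarrow> A $$ (i, k) \<noteq> 0 \<longrightarrow> T j \<otimes>\<^bsub>G\<^esub> T k = T k \<otimes>\<^bsub>G\<^esub> T j) \<and>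
     (\<forall>i<dim_row A.
        foldr (\<otimes>\<^bsub>G\<^esub>) (map (\<lambda>j. T j [^]\<^bsub>G\<^esub> (A $$ (i, j))) [0..<dim_col A]) \<one>\<^bsub>G\<^esub>
          = J [^]\<^bsub>G\<^esub> (b $ i))"

definition special_unitary :: "nat \<Rightarrow> complex mat monoid" where
  "special_unitary d =
     \<lparr>carrier = {U \<in> carrier_mat d d. mat_adjoint U * U = 1\<^sub>m d \<and> det U = 1},
      monoid.mult = (*), one = 1\<^sub>m d\<rparr>"

definition diagonal_torus :: "nat \<Rightarrow> complex mat set" where
  "diagonal_torus d = {t \<in> carrier (special_unitary d). diagonal_mat t}"

definition torus_torsion :: "nat \<Rightarrow> nat \<Rightarrow> complex mat set" where
  "torus_torsion d q =
     {t \<in> diagonal_torus d. t [^]\<^bsub>special_unitary d\<^esub> q = \<one>\<^bsub>special_unitary d\<^esub>}"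

definition shift_mat :: "nat \<Rightarrow> complex mat" where
  "shift_mat p = mat p p (\<lambda>(i, j). if i = (j + 1) mod p then 1 else 0)"

definition E1 :: "nat \<Rightarrow> nat \<Rightarrow> complex mat set" where
  "E1 p m = generate (special_unitary p) (torus_torsion p (p ^ m) \<union> {shift_mat p})"

definition kronecker :: "complex mat \<Rightarrow> complex mat \<Rightarrow> complex mat" where
  "kronecker M N = mat (dim_row M * dim_row N) (dim_col M * dim_col N)
     (\<lambda>(i, j). M $$ (i div dim_row N, j div dim_col N) * N $$ (i mod dim_row N, j mod dim_col N))"

(* M_1 \<otimes> ... \<otimes> M_n, as a matrix in the lexicographically ordered product basis of the
   n-fold tensor power. *)
definition tensor_list :: "complex mat list \<Rightarrow> complex mat" where
  "tensor_list Ms = foldr kronecker Ms (1\<^sub>m 1)"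

definition E_group :: "nat \<Rightarrow> nat \<Rightarrow> nat \<Rightarrow> complex mat monoid" where
  "E_group n p m =
     \<lparr>carrier = {tensor_list Ms | Ms. length Ms = n \<and> set Ms \<subseteq> E1 p m},
      monoid.mult = (*), one = 1\<^sub>m (p ^ n)\<rparr>"

definition E_center :: "nat \<Rightarrow> nat \<Rightarrow> complex mat" where
  "E_center n p = cis (2 * pi / real p) \<cdot>\<^sub>m 1\<^sub>m (p ^ n)"

(* integer_mod_group p is additive: the distinguished element 1 is a generator, not the neutral
   element. *)
lemma system_solution_integer_mod_group_iff:
  assumes p: "p > 0" and sys: "linear_system p r c A b"
  shows "system_solution p (integer_mod_group p) 1 A b x \<longleftrightarrow>
    (\<forall>j<c. x j \<in> {0..<int p}) \<and> (\<forall>i<r. [(A *\<^sub>v vec c x) $ i = b $ i] (mod int p))"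
proof -
  have d: "dim_row A = r" "dim_col A = c" "dim_vec b = r"
    using sys by (auto simp: linear_system_def)
  have bi: "b $ i mod int p = b $ i" if "i < r" for i
    using sys p that by (auto simp: linear_system_def carrier_integer_mod_group)
  have fold_eq: "foldr (\<lambda>u v. (u + v) mod int p) (map (\<lambda>j. f j * x j mod int p) js) 0
      = (\<Sum>j\<leftarrow>js. f j * x j) mod int p" for f :: "nat \<Rightarrow> int" and js
    by (induction js) (auto simp: mod_simps)
  have row: "(A *\<^sub>v vec c x) $ i = (\<Sum>j\<leftarrow>[0..<c]. A $$ (i, j) * x j)" if "i < r" for i
    using that d by (simp add: scalar_prod_def interv_sum_list_conv_sum_set_nat)
  show ?thesis
    unfolding system_solution_def d using p
    by (auto simp: carrier_integer_mod_group int_pow_integer_mod_group fold_eq cong_def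
        row[symmetric] bi add.commute simp del: index_mult_mat_vec)
qed

lemma mat_adjoint_index:
  assumes "U \<in> carrier_mat a b"
  shows "mat_adjoint U \<in> carrier_mat b a"
    and "i < b \<Longrightarrow> j < a \<Longrightarrow> mat_adjoint U $$ (i, j) = cnj (U $$ (j, i))"
  using assms unfolding mat_adjoint_def
  by (auto simp: mat_of_rows_def conjugate_vec_def)

lemma mat_adjoint_mult:
  assumes "U \<in> carrier_mat d d" "V \<in> carrier_mat d d"
  shows "mat_adjoint (U * V) = mat_adjoint V * mat_adjoint (U :: complex mat)"
proof (rule eq_matI)
  note c = mat_adjoint_index[OF assms(1)] mat_adjoint_index[OF assms(2)]
    mat_adjoint_index[OF mult_carrier_mat[OF assms]]
  show "dim_row (mat_adjoint (U * V)) = dim_row (mat_adjoint V * mat_adjoint U)"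
    "dim_col (mat_adjoint (U * V)) = dim_col (mat_adjoint V * mat_adjoint U)"
    using c(1,3,5) by auto
  fix i j assume "i < dim_row (mat_adjoint V * mat_adjoint U)" "j < dim_col (mat_adjoint V * mat_adjoint U)"
  then have ij: "i < d" "j < d" using c(1,3) by auto
  show "mat_adjoint (U * V) $$ (i, j) = (mat_adjoint V * mat_adjoint U) $$ (i, j)"
    using ij assms c(1,3) c(2,4)
    by (simp add: c(6) scalar_prod_def mult.commute)
qed

lemma mat_adjoint_adjoint:
  "U \<in> carrier_mat d d \<Longrightarrow> mat_adjoint (mat_adjoint U) = (U :: complex mat)"
  by (rule eq_matI)
     (use mat_adjoint_index(1)[of "mat_adjoint U" d d] mat_adjoint_index[of U d d] in
       \<open>auto simp: mat_adjoint_index(2)[of "mat_adjoint U" d d]\<close>)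

lemma det_mat_adjoint:
  assumes U: "U \<in> carrier_mat d d"
  shows "det (mat_adjoint U) = cnj (det (U :: complex mat))"
proof -
  have "mat_adjoint U = transpose_mat (map_mat cnj U)"
    by (rule eq_matI) (use U mat_adjoint_index[OF U] in auto)
  moreover have "det (map_mat cnj U) = cnj (det U)"
    using U by (auto simp: Determinant.det_def intro!: sum.cong prod.cong)
  ultimately show ?thesis
    using U by (metis det_transpose map_carrier_mat)
qed

lemma group_special_unitary: "group (special_unitary d)"
proof (rule groupI)
  fix U V assume UV: "U \<in> carrier (special_unitary d)" "V \<in> carrier (special_unitary d)"
  then have c: "U \<in> carrier_mat d d" "V \<in> carrier_mat d d"
    and u: "mat_adjoint U * U = 1\<^sub>m d" "mat_adjoint V * V = 1\<^sub>m d"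
    by (auto simp: special_unitary_def)
  note a = mat_adjoint_index(1)[OF c(1)] mat_adjoint_index(1)[OF c(2)]
  have "mat_adjoint (U * V) * (U * V) = mat_adjoint V * ((mat_adjoint U * U) * V)"
    using c a by (simp add: mat_adjoint_mult assoc_mult_mat[of _ d d _ d _ d])
  then have "mat_adjoint (U * V) * (U * V) = 1\<^sub>m d" using u c by simp
  then show "U \<otimes>\<^bsub>special_unitary d\<^esub> V \<in> carrier (special_unitary d)"
    using UV c by (auto simp: special_unitary_def det_mult[of U d])
next
  have "mat_adjoint (1\<^sub>m d) = (1\<^sub>m d :: complex mat)"
    by (rule eq_matI) (use mat_adjoint_index[of "1\<^sub>m d" d d] in auto)
  then show "\<one>\<^bsub>special_unitary d\<^esub> \<in> carrier (special_unitary d)"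
    by (auto simp: special_unitary_def)
next
  fix U assume "U \<in> carrier (special_unitary d)"
  then have c: "U \<in> carrier_mat d d" and u: "mat_adjoint U * U = 1\<^sub>m d" and dt: "det U = 1"
    by (auto simp: special_unitary_def)
  note a = mat_adjoint_index(1)[OF c]
  have "U * mat_adjoint U = 1\<^sub>m d" using u a c by (rule mat_mult_left_right_inverse[rotated 2])
  then have "mat_adjoint U \<in> carrier (special_unitary d)"
    using a dt c by (auto simp: special_unitary_def mat_adjoint_adjoint det_mat_adjoint)
  then show "\<exists>V\<in>carrier (special_unitary d). V \<otimes>\<^bsub>special_unitary d\<^esub> U = \<one>\<^bsub>special_unitary d\<^esub>"
    using u by (auto simp: special_unitary_def)
qed (auto simp: special_unitary_def)

lemma sum_div_mod:
  fixes f g :: "nat \<Rightarrow> 'a :: comm_semiring_0"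
  shows "(\<Sum>k<a * b. f (k div b) * g (k mod b)) = sum f {..<a} * sum g {..<b}"
proof (cases "b = 0")
  case False
  have bound: "i * b + j < a * b" if "i < a" "j < b" for i j
  proof -
    have "i * b + j < (i + 1) * b" using that by simp
    also have "\<dots> \<le> a * b" using that by (intro mult_le_mono1) auto
    finally show ?thesis .
  qed
  have "(\<Sum>k<a * b. f (k div b) * g (k mod b)) = (\<Sum>(i, j)\<in>{..<a} \<times> {..<b}. f i * g j)"
    by (rule sum.reindex_bij_witness[where i = "\<lambda>(i, j). i * b + j" and j = "\<lambda>k. (k div b, k mod b)"])
       (use False in \<open>auto simp: less_mult_imp_div_less bound\<close>)
  then show ?thesis by (simp add: sum_product sum.cartesian_product)
qed simp

lemma kronecker_carrier:
  "M \<in> carrier_mat a a \<Longrightarrow> N \<in> carrier_mat b b \<Longrightarrow> kronecker M N \<in> carrier_mat (a * b) (a * b)"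
  by (auto simp: kronecker_def)

lemma kronecker_mult:
  assumes "M \<in> carrier_mat a a" "M' \<in> carrier_mat a a"
    and "N \<in> carrier_mat b b" "N' \<in> carrier_mat b b"
  shows "kronecker M N * kronecker M' N' = kronecker (M * M') (N * N')"
proof (rule eq_matI)
  note d = kronecker_carrier[OF assms(1,3)] kronecker_carrier[OF assms(2,4)]
    kronecker_carrier[OF mult_carrier_mat[OF assms(1,2)] mult_carrier_mat[OF assms(3,4)]]
  show "dim_row (kronecker M N * kronecker M' N') = dim_row (kronecker (M * M') (N * N'))"
    "dim_col (kronecker M N * kronecker M' N') = dim_col (kronecker (M * M') (N * N'))"
    using d by auto
  fix i j assume "i < dim_row (kronecker (M * M') (N * N'))" "j < dim_col (kronecker (M * M') (N * N'))"
  then have ij: "i < a * b" "j < a * b" using d(3) by auto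
  then have b: "b > 0" by (cases b) auto
  have q: "i div b < a" "j div b < a" "i mod b < b" "j mod b < b"
    using ij b by (auto simp: less_mult_imp_div_less)
  have "(kronecker M N * kronecker M' N') $$ (i, j)
      = (\<Sum>k<a * b. (M $$ (i div b, k div b) * M' $$ (k div b, j div b)) *
                   (N $$ (i mod b, k mod b) * N' $$ (k mod b, j mod b)))"
    using ij d(1,2) assms
    by (auto simp: scalar_prod_def kronecker_def lessThan_atLeast0 intro!: sum.cong)
  also have "\<dots> = kronecker (M * M') (N * N') $$ (i, j)"
    using ij q assms
    by (simp add: sum_div_mod[where f = "\<lambda>k. M $$ (i div b, k) * M' $$ (k, j div b)"
          and g = "\<lambda>k. N $$ (i mod b, k) * N' $$ (k, j mod b)"])
       (simp add: kronecker_def scalar_prod_def lessThan_atLeast0)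
  finally show "(kronecker M N * kronecker M' N') $$ (i, j) = kronecker (M * M') (N * N') $$ (i, j)" .
qed

lemma kronecker_one: "kronecker (1\<^sub>m a) (1\<^sub>m b) = 1\<^sub>m (a * b)"
proof (rule eq_matI)
  fix i j assume ij: "i < dim_row (1\<^sub>m (a * b) :: complex mat)" "j < dim_col (1\<^sub>m (a * b) :: complex mat)"
  then have "b > 0" by (cases b) auto
  moreover have "i = j" if "i div b = j div b" "i mod b = j mod b"
    using that by (metis div_mult_mod_eq)
  ultimately show "kronecker (1\<^sub>m a) (1\<^sub>m b) $$ (i, j) = 1\<^sub>m (a * b) $$ (i, j)"
    using ij
    by (auto simp: kronecker_def less_mult_imp_div_less split: if_splits)
qed (auto simp: kronecker_def)

lemma kronecker_smult:
  assumes "M \<in> carrier_mat a a" "N \<in> carrier_mat b b"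
  shows "kronecker (z \<cdot>\<^sub>m M) N = z \<cdot>\<^sub>m kronecker M N"
proof (rule eq_matI)
  fix i j assume ij: "i < dim_row (z \<cdot>\<^sub>m kronecker M N)" "j < dim_col (z \<cdot>\<^sub>m kronecker M N)"
  then have "i < a * b" "j < a * b" using kronecker_carrier[OF assms] by auto
  moreover from this have "b > 0" by (cases b) auto
  ultimately show "kronecker (z \<cdot>\<^sub>m M) N $$ (i, j) = (z \<cdot>\<^sub>m kronecker M N) $$ (i, j)"
    using assms by (auto simp: kronecker_def less_mult_imp_div_less)
qed (auto simp: kronecker_def)

lemma tensor_list_carrier:
  "set Ms \<subseteq> carrier_mat p p \<Longrightarrow> tensor_list Ms \<in> carrier_mat (p ^ length Ms) (p ^ length Ms)"
  by (induction Ms) (auto simp: tensor_list_def intro!: kronecker_carrier)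

lemma tensor_list_mult:
  assumes "length Ms = length Ns" "set Ms \<subseteq> carrier_mat p p" "set Ns \<subseteq> carrier_mat p p"
  shows "tensor_list Ms * tensor_list Ns = tensor_list (map2 (*) Ms Ns)"
  using assms
proof (induction Ms Ns rule: list_induct2)
  case Nil
  then show ?case by (simp add: tensor_list_def)
next
  case (Cons M Ms N Ns)
  have "tensor_list (M # Ms) * tensor_list (N # Ns)
      = kronecker M (tensor_list Ms) * kronecker N (tensor_list Ns)"
    by (simp add: tensor_list_def)
  also have "\<dots> = kronecker (M * N) (tensor_list Ms * tensor_list Ns)"
    using Cons tensor_list_carrier[of Ms p] tensor_list_carrier[of Ns p]
    by (intro kronecker_mult[of _ p _ _ "p ^ length Ms"]) auto
  finally show ?case using Cons by (simp add: tensor_list_def)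
qed

lemma tensor_list_one: "tensor_list (replicate n (1\<^sub>m p)) = 1\<^sub>m (p ^ n)"
  by (induction n) (auto simp: tensor_list_def kronecker_one)

lemma shift_mat_pow: "p > 0 \<Longrightarrow> shift_mat p ^\<^sub>m k = mat p p (\<lambda>(i, j). if i = (j + k) mod p then 1 else 0)"
proof (induction k)
  case 0
  then show ?case by (intro eq_matI) (auto simp: shift_mat_def)
next
  case (Suc k)
  show ?case
  proof (rule eq_matI)
    fix i j
    assume "i < dim_row (mat p p (\<lambda>(i, j). if i = (j + Suc k) mod p then 1 else 0 :: complex))"
      "j < dim_col (mat p p (\<lambda>(i, j). if i = (j + Suc k) mod p then 1 else 0 :: complex))"
    then have ij: "i < p" "j < p" by auto
    have "(shift_mat p ^\<^sub>m Suc k) $$ (i, j)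
        = (\<Sum>l = 0..<p. (if i = (l + k) mod p then 1 else 0) * (if l = (j + 1) mod p then 1 else 0))"
      using ij Suc by (simp add: scalar_prod_def shift_mat_def)
    also have "\<dots> = (\<Sum>l = 0..<p. if l = (j + 1) mod p then if i = (l + k) mod p then 1 else 0 else 0)"
      by (intro sum.cong) auto
    also have "\<dots> = (if i = ((j + 1) mod p + k) mod p then 1 else 0)"
      using Suc.prems by (subst sum.delta) auto
    finally show "(shift_mat p ^\<^sub>m Suc k) $$ (i, j)
        = mat p p (\<lambda>(i, j). if i = (j + Suc k) mod p then 1 else 0) $$ (i, j)"
      using ij by (simp add: mod_simps)
  qed (use Suc in \<open>auto simp: shift_mat_def\<close>)
qed

lemma shift_mat_special_unitary:
  assumes "odd p"
  shows "shift_mat p \<in> carrier (special_unitary p)"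
proof -
  have p: "p > 0" using assms by (cases p) auto
  have c: "shift_mat p \<in> carrier_mat p p" by (simp add: shift_mat_def)
  have "mat_adjoint (shift_mat p) * shift_mat p = 1\<^sub>m p"
  proof (rule eq_matI)
    fix i j assume "i < dim_row (1\<^sub>m p :: complex mat)" "j < dim_col (1\<^sub>m p :: complex mat)"
    then have ij: "i < p" "j < p" by auto
    have "(mat_adjoint (shift_mat p) * shift_mat p) $$ (i, j)
        = (\<Sum>l = 0..<p. mat_adjoint (shift_mat p) $$ (i, l) * shift_mat p $$ (l, j))"
      using ij c mat_adjoint_index(1)[OF c] by (auto simp: scalar_prod_def)
    also have "\<dots> = (\<Sum>l = 0..<p. if l = (j + 1) mod p then if l = (i + 1) mod p then 1 else 0 else 0)"
      by (rule sum.cong) (use ij mat_adjoint_index(2)[OF c] in \<open>auto simp: shift_mat_def\<close>)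
    also have "\<dots> = (if (j + 1) mod p = (i + 1) mod p then 1 else 0)"
      using p by (subst sum.delta) auto
    also have "(j + 1) mod p = (i + 1) mod p \<longleftrightarrow> i = j"
      using ij by (auto simp: mod_Suc split: if_splits)
    finally show "(mat_adjoint (shift_mat p) * shift_mat p) $$ (i, j) = 1\<^sub>m p $$ (i, j)"
      using ij by auto
  qed (use c mat_adjoint_index(1)[OF c] in auto)
  moreover have "det (shift_mat p) = 1"
  proof -
    have "mat_adjoint (shift_mat p) = transpose_mat (shift_mat p)"
    proof (rule eq_matI)
      fix i j assume "i < dim_row (transpose_mat (shift_mat p))" "j < dim_col (transpose_mat (shift_mat p))"
      then have "i < p" "j < p" using c by auto
      then show "mat_adjoint (shift_mat p) $$ (i, j) = transpose_mat (shift_mat p) $$ (i, j)"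
        using mat_adjoint_index(2)[OF c, of i j] by (simp add: shift_mat_def)
    qed (use c mat_adjoint_index(1)[OF c] in auto)
    then have "cnj (det (shift_mat p)) = det (shift_mat p)"
      using det_mat_adjoint[OF c] det_transpose[OF c] by simp
    then obtain x where x: "det (shift_mat p) = complex_of_real x"
      by (metis Reals_cases Reals_cnj_iff)
    have pow: "det (shift_mat p ^\<^sub>m k) = det (shift_mat p) ^ k" for k
      using c by (induction k) (auto simp: det_mult[of _ p] shift_mat_def)
    have "shift_mat p ^\<^sub>m p = 1\<^sub>m p"
      using p by (auto simp: shift_mat_pow)
    then have "x ^ p = 1 ^ p"
      using pow[of p] x by (metis Determinant.det_one of_real_1 of_real_eq_iff of_real_power power_one)
    then have "x = 1"
      using assms by (metis odd_real_root_power_cancel power_one)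
    with x show ?thesis by simp
  qed
  ultimately show ?thesis using c by (simp add: special_unitary_def)
qed

lemma subgroup_E1:
  assumes "odd p"
  shows "subgroup (E1 p m) (special_unitary p)"
  unfolding E1_def
  by (rule group.generate_is_subgroup[OF group_special_unitary])
     (use shift_mat_special_unitary[OF assms] in \<open>auto simp: torus_torsion_def diagonal_torus_def\<close>)

lemma group_E_group:
  assumes "odd p"
  shows "group (E_group n p m)"
proof (rule groupI)
  interpret S: subgroup "E1 p m" "special_unitary p" by (rule subgroup_E1[OF assms])
  interpret SU: group "special_unitary p" by (rule group_special_unitary)
  have E1_car: "E1 p m \<subseteq> carrier_mat p p"
    using S.subset by (auto simp: special_unitary_def)
  have one: "1\<^sub>m p \<in> E1 p m" using S.one_closed by (simp add: special_unitary_def)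
  have mult: "M * N \<in> E1 p m" if "M \<in> E1 p m" "N \<in> E1 p m" for M N
    using S.m_closed[OF that] by (simp add: special_unitary_def)
  have car: "U \<in> carrier_mat (p ^ n) (p ^ n)" if "U \<in> carrier (E_group n p m)" for U
    using that E1_car tensor_list_carrier[of _ p] by (auto simp: E_group_def)
  show "U \<otimes>\<^bsub>E_group n p m\<^esub> V \<in> carrier (E_group n p m)"
    if "U \<in> carrier (E_group n p m)" "V \<in> carrier (E_group n p m)" for U V
  proof -
    obtain Ms Ns where MN: "U = tensor_list Ms" "V = tensor_list Ns" "length Ms = n" "length Ns = n"
      "set Ms \<subseteq> E1 p m" "set Ns \<subseteq> E1 p m"
      using \<open>U \<in> _\<close> \<open>V \<in> _\<close> by (auto simp: E_group_def)
    have "set (map2 (*) Ms Ns) \<subseteq> E1 p m"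
      using MN(5,6) by (auto dest!: set_zip_leftD set_zip_rightD intro!: mult dest: set_zip_leftD set_zip_rightD elim!: in_set_zipE)
    moreover have "U * V = tensor_list (map2 (*) Ms Ns)"
      using MN E1_car by (auto intro!: tensor_list_mult[of _ _ p])
    ultimately show ?thesis
      using MN by (auto simp: E_group_def intro!: exI[of _ "map2 (*) Ms Ns"])
  qed
  show "\<one>\<^bsub>E_group n p m\<^esub> \<in> carrier (E_group n p m)"
    using one by (auto simp: E_group_def tensor_list_one[symmetric] intro!: exI[of _ "replicate n (1\<^sub>m p)"])
  show "U \<otimes>\<^bsub>E_group n p m\<^esub> V \<otimes>\<^bsub>E_group n p m\<^esub> W = U \<otimes>\<^bsub>E_group n p m\<^esub> (V \<otimes>\<^bsub>E_group n p m\<^esub> W)"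
    if "U \<in> carrier (E_group n p m)" "V \<in> carrier (E_group n p m)" "W \<in> carrier (E_group n p m)" for U V W
    using that[THEN car] assoc_mult_mat[of U "p ^ n" "p ^ n" V "p ^ n" W "p ^ n"]
    by (simp add: E_group_def)
  show "\<one>\<^bsub>E_group n p m\<^esub> \<otimes>\<^bsub>E_group n p m\<^esub> U = U" if "U \<in> carrier (E_group n p m)" for U
    using that[THEN car] by (simp add: E_group_def)
  show "\<exists>V\<in>carrier (E_group n p m). V \<otimes>\<^bsub>E_group n p m\<^esub> U = \<one>\<^bsub>E_group n p m\<^esub>"
    if U: "U \<in> carrier (E_group n p m)" for U
  proof -
    obtain Ms where Ms: "U = tensor_list Ms" "length Ms = n" "set Ms \<subseteq> E1 p m"
      using U by (auto simp: E_group_def)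
    define Ns where "Ns = map (m_inv (special_unitary p)) Ms"
    have Ns: "length Ns = n" "set Ns \<subseteq> E1 p m"
      using Ms S.m_inv_closed by (auto simp: Ns_def)
    have inv: "m_inv (special_unitary p) M * M = 1\<^sub>m p" if "M \<in> E1 p m" for M
      using SU.l_inv[of M] S.subset that by (auto simp: special_unitary_def)
    have "m_inv (special_unitary p) (Ms ! i) * Ms ! i = 1\<^sub>m p" if "i < n" for i
      using that Ms inv by (metis nth_mem subsetD)
    then have "map2 (*) Ns Ms = replicate n (1\<^sub>m p)"
      using Ms Ns by (intro nth_equalityI) (auto simp: Ns_def)
    moreover have "tensor_list Ns * U = tensor_list (map2 (*) Ns Ms)"
      using Ms Ns E1_car by (auto intro!: tensor_list_mult[of _ _ p])
    ultimately show ?thesis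
      using Ns by (auto simp: E_group_def tensor_list_one intro!: bexI[of _ "tensor_list Ns"])
  qed
qed

lemma E_center_in_E_group:
  assumes "p > 0" "n \<ge> 1" "m \<ge> 1"
  shows "E_center n p \<in> carrier (E_group n p m)"
proof -
  define w where "w = cis (2 * pi / real p)"
  have wp: "w ^ p = 1" using assms by (simp add: w_def DeMoivre)
  have wc: "cnj w * w = 1" by (simp add: w_def cis_cnj cis_mult)
  have "mat_adjoint (w \<cdot>\<^sub>m 1\<^sub>m p) = cnj w \<cdot>\<^sub>m 1\<^sub>m p"
    by (rule eq_matI) (use mat_adjoint_index[of "w \<cdot>\<^sub>m 1\<^sub>m p" p p] in auto)
  then have su: "w \<cdot>\<^sub>m 1\<^sub>m p \<in> carrier (special_unitary p)"
    using wp wc by (auto simp: special_unitary_def mult.commute intro!: eq_matI)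
  have pow: "(w \<cdot>\<^sub>m 1\<^sub>m p) [^]\<^bsub>special_unitary p\<^esub> k = w ^ k \<cdot>\<^sub>m 1\<^sub>m p" for k :: nat
    by (induction k) (auto simp: special_unitary_def intro!: eq_matI)
  have "w ^ (p ^ m) = (w ^ p) ^ (p ^ (m - 1))"
    using assms by (simp add: power_mult[symmetric] power_Suc[symmetric] del: power_Suc)
  then have "w ^ (p ^ m) = 1" using wp by simp
  then have "w \<cdot>\<^sub>m 1\<^sub>m p \<in> torus_torsion p (p ^ m)"
    using su pow[of "p ^ m"]
    by (auto simp: torus_torsion_def diagonal_torus_def diagonal_mat_def special_unitary_def)
  then have wE: "w \<cdot>\<^sub>m 1\<^sub>m p \<in> E1 p m"
    unfolding E1_def by (intro generate.incl) auto
  have one: "1\<^sub>m p \<in> E1 p m"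
    using generate.one[of "special_unitary p"] unfolding E1_def by (simp add: special_unitary_def)
  obtain k where n: "n = Suc k" using assms by (cases n) auto
  have "E_center n p = tensor_list (w \<cdot>\<^sub>m 1\<^sub>m p # replicate k (1\<^sub>m p))"
    using kronecker_smult[of "1\<^sub>m p" p "1\<^sub>m (p ^ k)" "p ^ k" w] tensor_list_one[of k p]
    by (simp add: tensor_list_def E_center_def n w_def kronecker_one)
  moreover have "length (w \<cdot>\<^sub>m 1\<^sub>m p # replicate k (1\<^sub>m p)) = n" by (simp add: n)
  moreover have "set (w \<cdot>\<^sub>m 1\<^sub>m p # replicate k (1\<^sub>m p)) \<subseteq> E1 p m" using wE one by auto
  ultimately show ?thesis unfolding E_group_def by (auto simp del: set_simps)
qed

lemma E_center_central:
  assumes "odd p" "U \<in> carrier (E_group n p m)"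
  shows "E_center n p \<otimes>\<^bsub>E_group n p m\<^esub> U = U \<otimes>\<^bsub>E_group n p m\<^esub> E_center n p"
proof -
  interpret S: subgroup "E1 p m" "special_unitary p" by (rule subgroup_E1[OF assms(1)])
  have "E1 p m \<subseteq> carrier_mat p p"
    using S.subset by (auto simp: special_unitary_def)
  then have "U \<in> carrier_mat (p ^ n) (p ^ n)"
    using assms(2) tensor_list_carrier[of _ p] by (auto simp: E_group_def)
  then show ?thesis
    using mult_smult_assoc_mat[of "1\<^sub>m (p ^ n)" "p ^ n" "p ^ n" U "p ^ n"]
      mult_smult_distrib[of U "p ^ n" "p ^ n" "1\<^sub>m (p ^ n)" "p ^ n"]
    by (simp add: E_group_def E_center_def)
qed

lemma E_center_order:
  assumes "odd p" "n \<ge> 1" "m \<ge> 1"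
  shows "group.ord (E_group n p m) (E_center n p) = p"
proof -
  interpret group "E_group n p m" by (rule group_E_group[OF assms(1)])
  define w where "w = cis (2 * pi / real p)"
  have p: "p > 0" using assms by (cases p) auto
  have pow: "E_center n p [^]\<^bsub>E_group n p m\<^esub> k = w ^ k \<cdot>\<^sub>m 1\<^sub>m (p ^ n)" for k :: nat
    by (induction k) (auto simp: E_group_def E_center_def w_def intro!: eq_matI)
  have "E_center n p [^]\<^bsub>E_group n p m\<^esub> k = \<one>\<^bsub>E_group n p m\<^esub> \<longleftrightarrow> p dvd k" for k :: nat
  proof -
    have "w ^ k \<cdot>\<^sub>m 1\<^sub>m (p ^ n) = 1\<^sub>m (p ^ n) \<longleftrightarrow> w ^ k = 1"
    proof
      assume "w ^ k \<cdot>\<^sub>m 1\<^sub>m (p ^ n) = 1\<^sub>m (p ^ n)"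
      then have "(w ^ k \<cdot>\<^sub>m 1\<^sub>m (p ^ n)) $$ (0, 0) = 1\<^sub>m (p ^ n) $$ (0, 0)" by simp
      then show "w ^ k = 1" using p by simp
    qed (auto intro!: eq_matI)
    also have "w ^ k = 1 \<longleftrightarrow> p dvd k"
    proof -
      have wk: "w ^ k = cis (2 * pi * real k / real p)" by (simp add: w_def DeMoivre mult_ac)
      show ?thesis
      proof
        assume "w ^ k = 1"
        then have "cos (2 * pi * real k / real p) = 1" by (simp add: wk complex_eq_iff)
        then obtain z :: int where "2 * pi * real k / real p = real_of_int z * 2 * pi"
          using cos_one_2pi_int by auto
        then have "real k = real_of_int z * real p" using p by (simp add: field_simps)
        then have "int k = z * int p" by (metis of_int_eq_iff of_int_mult of_int_of_nat_eq)
        then show "p dvd k" by (metis dvd_triv_right int_dvd_int_iff)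
      next
        assume "p dvd k"
        then obtain l where "k = p * l" by (elim dvdE)
        then show "w ^ k = 1" using p cis_multiple_2pi[of "real l"] wk by (simp add: mult.assoc)
      qed
    qed
    finally show ?thesis by (simp add: pow) (simp add: E_group_def)
  qed
  then show ?thesis
    using pow_eq_id[OF E_center_in_E_group[OF p assms(2,3)]]
    by (metis dvd_antisym dvd_refl)
qed

end

theory Submission
  imports Defs
begin

text \<open>
  Suppose a group \<open>G\<close> carries a map \<open>f\<close> to the complex numbers that is multiplicative on commuting
  pairs and sends \<open>J\<close> to \<open>\<omega> = exp (2 \<pi> i / p)\<close>.  The equations of a linear system multiply only
  commuting elements, so \<open>f\<close> carries each of them over to complex numbers; as \<open>f (T\<^sub>j)\<close> is a \<open>p\<close>-th
  root of unity \<open>\<omega>\<close> to the \<open>x\<^sub>j\<close>, the exponents \<open>x\<^sub>j\<close> solve the system modulo \<open>p\<close>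
  (\<open>solution_mod_p\<close>).  It remains to construct such a map on the group of operators
  \<open>M\<^sub>1 \<otimes> \<dots> \<otimes> M\<^sub>n\<close>.

  Tensor products commute exactly if their factors commute up to scalars \<open>c\<^sub>i\<close> whose product
  is 1.  So it suffices to find a map \<open>\<chi>\<close> on the factors with \<open>\<chi> (s M) = s \<chi> (M)\<close> and, whenever
  \<open>M N = c N M\<close>, with \<open>\<chi> (M N) = \<chi> (M) \<chi> (N) c\<^sup>h\<close> where \<open>h = (p + 1) / 2\<close> represents \<open>1 / 2\<close> modulo \<open>p\<close>:
  the product of \<open>\<chi>\<close> over the factors then depends on the tensor product only, and
  the corrections \<open>c\<^sub>i\<^sup>h\<close> cancel for commuting operators.  This is where \<open>p\<close> has to be odd.

  Every element of \<open>E\<^sub>1\<close> is an invertible diagonal matrix times a power \<open>X\<^sup>a\<close> of the cyclic shift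
  (\<open>E1_monomial\<close>), and \<open>\<chi>\<close> can be defined on all matrices of this form.
  For Weyl operators \<open>M = l Z\<^sup>k X\<^sup>a\<close>, with \<open>Z\<close> the diagonal matrix of the powers of \<open>\<omega>\<close>, the map
  \<open>\<chi> (M) = l \<omega>\<close> to the power \<open>k a / 2\<close> does what is wanted; it is the entry of \<open>M\<close> at row \<open>a / 2\<close>,
  column \<open>- a / 2\<close> (\<open>symbol_mult\<close>).  A matrix \<open>M\<close> with shift \<open>a \<noteq> 0\<close> becomes a Weyl operator after
  conjugation with some diagonal matrix \<open>P\<close> (\<open>gauge_exists\<close>), and the same \<open>P\<close> then turns everything
  that commutes with \<open>M\<close> up to a scalar into a Weyl operator (\<open>gauge_transfer\<close>).  Hence matrices of nonzero
  shift that commute up to a scalar admit the same \<open>P\<close>, so that a choice depending only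
  on the set of admissible \<open>P\<close> is automatically coherent, and the identity for \<open>\<chi>\<close> may be checked on Weyl
  operators (\<open>weyl_character_mult\<close>).  For diagonal matrices \<open>P\<close> does not matter, and \<open>\<chi>\<close> is
  the entry at \<open>(0, 0)\<close>.
\<close>

section \<open>Characters on commuting pairs and solutions modulo p\<close>

lemma (in group) commute_foldr:
  assumes "y \<in> carrier G" "set xs \<subseteq> carrier G" "\<And>x. x \<in> set xs \<Longrightarrow> y \<otimes> x = x \<otimes> y"
  shows "y \<otimes> foldr (\<otimes>) xs \<one> = foldr (\<otimes>) xs \<one> \<otimes> y"
proof -
  have "foldr (\<otimes>) xs \<one> \<in> carrier G \<and> y \<otimes> foldr (\<otimes>) xs \<one> = foldr (\<otimes>) xs \<one> \<otimes> y"
    using assms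
  proof (induction xs)
    case (Cons x xs)
    then have c: "x \<in> carrier G" "foldr (\<otimes>) xs \<one> \<in> carrier G" and
      e: "y \<otimes> x = x \<otimes> y" "y \<otimes> foldr (\<otimes>) xs \<one> = foldr (\<otimes>) xs \<one> \<otimes> y" by auto
    have "y \<otimes> (x \<otimes> foldr (\<otimes>) xs \<one>) = (x \<otimes> y) \<otimes> foldr (\<otimes>) xs \<one>"
      using c e(1) assms(1) by (simp add: m_assoc[symmetric])
    also have "\<dots> = (x \<otimes> foldr (\<otimes>) xs \<one>) \<otimes> y"
      using c e(2) assms(1) by (simp add: m_assoc)
    finally show ?case using c by simp
  qed (use assms(1) in simp)
  then show ?thesis ..
qed

locale commuting_character = group G for G (structure) +
  fixes f :: "'a \<Rightarrow> complex"
  assumes f_one: "f \<one> = 1"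
    and f_mult: "\<lbrakk>x \<in> carrier G; y \<in> carrier G; x \<otimes> y = y \<otimes> x\<rbrakk> \<Longrightarrow> f (x \<otimes> y) = f x * f y"
begin

lemma f_foldr:
  assumes "set xs \<subseteq> carrier G" "\<And>x y. x \<in> set xs \<Longrightarrow> y \<in> set xs \<Longrightarrow> x \<otimes> y = y \<otimes> x"
  shows "f (foldr (\<otimes>) xs \<one>) = prod_list (map f xs)"
  using assms
proof (induction xs)
  case (Cons x xs)
  have "foldr (\<otimes>) xs \<one> \<in> carrier G" using Cons.prems(1) by (induction xs) auto
  moreover have "x \<otimes> foldr (\<otimes>) xs \<one> = foldr (\<otimes>) xs \<one> \<otimes> x"
    using Cons.prems by (intro commute_foldr) auto
  ultimately show ?case using Cons f_mult by simp
qed (simp add: f_one)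

lemma f_pow:
  assumes "x \<in> carrier G"
  shows "f (x [^] (k :: nat)) = f x ^ k"
proof (induction k)
  case (Suc k)
  have "x [^] k \<otimes> x = x \<otimes> x [^] k" using assms nat_pow_Suc2 by simp
  then show ?case using Suc assms f_mult by simp
qed (simp add: f_one)

end

lemma root_of_unity_power_cong:
  fixes u v :: nat
  assumes p: "p > 0" and eq: "cis (2 * pi / real p) ^ u = cis (2 * pi / real p) ^ v"
  shows "[u = v] (mod p)"
proof -
  let ?w = "cis (2 * pi / real p)"
  have "?w ^ p = 1" using p by (simp add: DeMoivre)
  then have "?w ^ k = ?w ^ (k mod p)" for k
    by (metis mult.left_neutral mult_div_mod_eq power_add power_mult power_one)
  also have "?w ^ (k mod p) = cis (2 * pi * real (k mod p) / real p)" for k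
    by (simp add: DeMoivre mult_ac)
  finally have "cis (2 * pi * real (u mod p) / real p) = cis (2 * pi * real (v mod p) / real p)"
    using eq by metis
  then show ?thesis
    using bij_betw_imp_inj_on[OF bij_betw_roots_unity[OF p]] p
    by (auto simp: cong_def inj_on_def)
qed

text \<open>
  Powers of the \<open>T\<^sub>j\<close> that occur in one row commute, because a vanishing coefficient contributes the
  identity; so \<open>f\<close> may be applied to the row factor by factor.
\<close>
lemma (in commuting_character) solution_mod_p:
  assumes p: "p > 0" and J: "J \<in> carrier G" and f_J: "f J = cis (2 * pi / real p)"
    and sys: "linear_system p r c A b" and T: "system_solution p G J A b T"
  shows "\<exists>x. system_solution p (integer_mod_group p) 1 A b x"
proof -
  let ?w = "cis (2 * pi / real p)"
  have d: "dim_row A = r" "dim_col A = c" "dim_vec b = r"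
    using sys by (auto simp: linear_system_def)
  have A0: "A $$ (i, j) \<ge> 0" if "i < r" "j < c" for i j
    using sys p that by (auto simp: linear_system_def carrier_integer_mod_group)
  have b0: "b $ i \<ge> 0" if "i < r" for i
    using sys p that by (auto simp: linear_system_def carrier_integer_mod_group)
  have Tc: "T j \<in> carrier G" and Tp: "T j [^]\<^bsub>G\<^esub> p = \<one>\<^bsub>G\<^esub>" if "j < c" for j
    using T that d by (auto simp: system_solution_def)
  have "\<exists>y<p. f (T j) = ?w ^ y" if "j < c" for j
  proof -
    have "f (T j) ^ p = 1" using f_pow[OF Tc[OF that], of p] Tp[OF that] f_one by simp
    then have "f (T j) \<in> (\<lambda>k. cis (2 * pi * real k / real p)) ` {..<p}"
      using bij_betw_imp_surj_on[OF bij_betw_roots_unity[OF p]] by blast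
    then show ?thesis by (auto simp: DeMoivre mult_ac)
  qed
  then obtain y where y: "\<And>j. j < c \<Longrightarrow> y j < p \<and> f (T j) = ?w ^ y j" by metis
  have row: "[(A *\<^sub>v vec c (\<lambda>j. int (y j))) $ i = b $ i] (mod int p)" if i: "i < r" for i
  proof -
    define e where "e j = nat (A $$ (i, j))" for j
    define gs where "gs = map (\<lambda>j. T j [^]\<^bsub>G\<^esub> e j) [0..<c]"
    have pow: "T j [^]\<^bsub>G\<^esub> (A $$ (i, j)) = T j [^]\<^bsub>G\<^esub> e j" if "j < c" for j
      using A0[OF i that] by (metis e_def int_nat_eq int_pow_int)
    have comm: "T j [^]\<^bsub>G\<^esub> e j \<otimes>\<^bsub>G\<^esub> T k [^]\<^bsub>G\<^esub> e k = T k [^]\<^bsub>G\<^esub> e k \<otimes>\<^bsub>G\<^esub> T j [^]\<^bsub>G\<^esub> e j"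
      if jk: "j < c" "k < c" for j k
    proof (cases "A $$ (i, j) = 0 \<or> A $$ (i, k) = 0")
      case True
      then show ?thesis using Tc jk by (auto simp: e_def)
    next
      case False
      then have "T j \<otimes>\<^bsub>G\<^esub> T k = T k \<otimes>\<^bsub>G\<^esub> T j"
        using T i jk d by (auto simp: system_solution_def)
      then have "T j [^]\<^bsub>G\<^esub> e j \<otimes>\<^bsub>G\<^esub> T k = T k \<otimes>\<^bsub>G\<^esub> T j [^]\<^bsub>G\<^esub> e j"
        using Tc jk by (intro group_commutes_pow) auto
      then show ?thesis
        using Tc jk group_commutes_pow[of "T k" "T j [^]\<^bsub>G\<^esub> e j" "e k"] by simp
    qed
    have "foldr (\<otimes>\<^bsub>G\<^esub>) gs \<one>\<^bsub>G\<^esub> = J [^]\<^bsub>G\<^esub> (b $ i)"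
    proof -
      have "gs = map (\<lambda>j. T j [^]\<^bsub>G\<^esub> (A $$ (i, j))) [0..<c]"
        by (auto simp: gs_def pow)
      then show ?thesis using T i d by (simp add: system_solution_def)
    qed
    also have "\<dots> = J [^]\<^bsub>G\<^esub> nat (b $ i)" using b0[OF i] by (metis int_nat_eq int_pow_int)
    finally have "f (foldr (\<otimes>\<^bsub>G\<^esub>) gs \<one>\<^bsub>G\<^esub>) = ?w ^ nat (b $ i)"
      by (simp add: f_pow[OF J] f_J)
    moreover have "f (foldr (\<otimes>\<^bsub>G\<^esub>) gs \<one>\<^bsub>G\<^esub>) = prod_list (map f gs)"
      by (rule f_foldr) (auto simp: gs_def Tc comm)
    moreover have "map f gs = map (\<lambda>j. ?w ^ (y j * e j)) [0..<c]"
      using y by (auto simp: gs_def f_pow[OF Tc] power_mult)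
    moreover have "prod_list (map (\<lambda>j. ?w ^ (y j * e j)) [0..<c]) = ?w ^ (\<Sum>j<c. y j * e j)"
      by (simp add: power_sum lessThan_atLeast0 flip: prod.distinct_set_conv_list)
    ultimately have "?w ^ (\<Sum>j<c. y j * e j) = ?w ^ nat (b $ i)" by simp
    then have "[(\<Sum>j<c. y j * e j) = nat (b $ i)] (mod p)"
      by (rule root_of_unity_power_cong[OF p])
    then have "[int (\<Sum>j<c. y j * e j) = int (nat (b $ i))] (mod int p)"
      by (simp only: cong_int_iff)
    moreover have "int (\<Sum>j<c. y j * e j) = (A *\<^sub>v vec c (\<lambda>j. int (y j))) $ i"
      using i d A0[OF i]
      by (auto simp: scalar_prod_def e_def lessThan_atLeast0 mult.commute intro!: sum.cong)
    ultimately show ?thesis using b0[OF i] by simp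
  qed
  have "\<forall>j<c. int (y j) \<in> {0..<int p}" using y by auto
  then show ?thesis
    using row system_solution_integer_mod_group_iff[OF p sys, of "\<lambda>j. int (y j)"] by auto
qed

section \<open>Kronecker products up to scalars\<close>

lemma mult_add_less:
  fixes a b i k :: nat
  assumes "i < a" "k < b"
  shows "i * b + k < a * b"
proof -
  have "i * b + k < Suc i * b" using assms by simp
  also have "\<dots> \<le> a * b" using assms by (intro mult_le_mono1) simp
  finally show ?thesis .
qed

lemma smult_smult_mat: "s \<cdot>\<^sub>m (t \<cdot>\<^sub>m M) = (s * t :: 'a :: semigroup_mult) \<cdot>\<^sub>m M"
  by (rule eq_matI) (auto simp: mult.assoc)

lemma one_smult_mat: "(1 :: 'a :: monoid_mult) \<cdot>\<^sub>m M = M"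
  by (rule eq_matI) auto

lemma kronecker_index:
  assumes "M \<in> carrier_mat a a" "N \<in> carrier_mat b b" "i < a" "j < a" "k < b" "l < b"
  shows "kronecker M N $$ (i * b + k, j * b + l) = M $$ (i, j) * N $$ (k, l)"
  using assms by (simp add: kronecker_def mult_add_less)

lemma nonzero_mat_entry:
  assumes "M \<in> carrier_mat a a" "M \<noteq> 0\<^sub>m a a"
  obtains i j where "i < a" "j < a" "M $$ (i, j) \<noteq> 0"
proof -
  have "\<exists>i<a. \<exists>j<a. M $$ (i, j) \<noteq> 0"
  proof (rule ccontr)
    assume "\<not> ?thesis"
    then have "M = 0\<^sub>m a a" using assms(1) by (intro eq_matI) auto
    then show False using assms(2) by simp
  qed
  then show ?thesis using that by blast
qed

lemma kronecker_nonzero: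
  assumes M: "M \<in> carrier_mat a a" and N: "N \<in> carrier_mat b b"
    and "M \<noteq> 0\<^sub>m a a" "N \<noteq> 0\<^sub>m b b"
  shows "kronecker M N \<noteq> 0\<^sub>m (a * b) (a * b)"
proof
  assume z: "kronecker M N = 0\<^sub>m (a * b) (a * b)"
  obtain i j where ij: "i < a" "j < a" "M $$ (i, j) \<noteq> 0" using M assms(3) by (rule nonzero_mat_entry)
  obtain k l where kl: "k < b" "l < b" "N $$ (k, l) \<noteq> 0" using N assms(4) by (rule nonzero_mat_entry)
  have "kronecker M N $$ (i * b + k, j * b + l) = 0" using ij kl z by (simp add: mult_add_less)
  then show False using kronecker_index[OF M N ij(1,2) kl(1,2)] ij kl by simp
qed

text \<open>
  A pure tensor determines its factors up to a scalar, since fixing a nonzero entry of one factor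
  recovers the other.
\<close>
lemma kronecker_eq_smultE:
  assumes M: "M \<in> carrier_mat a a" and N: "N \<in> carrier_mat a a"
    and A: "A \<in> carrier_mat b b" and B: "B \<in> carrier_mat b b"
    and "M \<noteq> 0\<^sub>m a a" "A \<noteq> 0\<^sub>m b b"
    and eq: "kronecker M A = s \<cdot>\<^sub>m kronecker N B"
  obtains c where "c \<noteq> 0" "M = c \<cdot>\<^sub>m N" "A = (s / c) \<cdot>\<^sub>m B"
proof -
  have e: "M $$ (i, j) * A $$ (k, l) = s * (N $$ (i, j) * B $$ (k, l))"
    if "i < a" "j < a" "k < b" "l < b" for i j k l
  proof -
    have "kronecker M A $$ (i * b + k, j * b + l) = s * kronecker N B $$ (i * b + k, j * b + l)"
      using that mult_add_less kronecker_carrier[OF N B] by (simp add: eq)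
    then show ?thesis using that kronecker_index[OF M A] kronecker_index[OF N B] by simp
  qed
  obtain i j where ij: "i < a" "j < a" "M $$ (i, j) \<noteq> 0" using M assms(5) by (rule nonzero_mat_entry)
  obtain k l where kl: "k < b" "l < b" "A $$ (k, l) \<noteq> 0" using A assms(6) by (rule nonzero_mat_entry)
  define c where "c = s * B $$ (k, l) / A $$ (k, l)"
  have Mc: "M $$ (i', j') = c * N $$ (i', j')" if "i' < a" "j' < a" for i' j'
    using e[OF that kl(1,2)] kl(3) by (simp add: c_def field_simps)
  have c0: "c \<noteq> 0" using Mc[OF ij(1,2)] ij(3) by auto
  have N0: "N $$ (i, j) \<noteq> 0" using Mc[OF ij(1,2)] ij(3) by auto
  have Ac: "A $$ (k', l') = (s / c) * B $$ (k', l')" if "k' < b" "l' < b" for k' l'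
    using e[OF ij(1,2) that] N0 c0 unfolding Mc[OF ij(1,2)] by (simp add: field_simps)
  show ?thesis
  proof
    show "M = c \<cdot>\<^sub>m N" using M N Mc by (intro eq_matI) auto
    show "A = (s / c) \<cdot>\<^sub>m B" using A B Ac by (intro eq_matI) auto
  qed (rule c0)
qed

section \<open>Diagonal matrices times cyclic shifts\<close>

locale odd_prime =
  fixes p :: nat
  assumes prime_p: "prime p" and odd_p: "odd p"
begin

lemma p_pos: "p > 0"
  using prime_p by (simp add: prime_gt_0_nat)

definition half :: nat where
  "half = (p + 1) div 2"

lemma two_half: "2 * half = p + 1"
  using odd_p by (simp add: half_def)

lemma half_cong: "[2 * (x * int half) = x] (mod int p)"
proof -
  have "2 * (x * int half) = x * int (2 * half)" by simp
  also have "\<dots> = x + int p * x" unfolding two_half by (simp add: algebra_simps)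
  finally show ?thesis by (simp add: cong_def)
qed

text \<open>
  Rows and columns are indexed by the integers modulo \<open>p\<close>, so that shifts of indices need no
  case distinction at the boundary.
\<close>
definition entry :: "complex mat \<Rightarrow> int \<Rightarrow> int \<Rightarrow> complex" where
  "entry M i j = M $$ (nat (i mod int p), nat (j mod int p))"

lemma entry_cong: "[i = i'] (mod int p) \<Longrightarrow> [j = j'] (mod int p) \<Longrightarrow> entry M i j = entry M i' j'"
  by (simp add: entry_def cong_def)

lemma nat_mod_less: "nat (i mod int p) < p"
  using p_pos by (simp add: nat_less_iff)

lemma entry_smult: "M \<in> carrier_mat p p \<Longrightarrow> entry (s \<cdot>\<^sub>m M) i j = s * entry M i j"
  using nat_mod_less by (simp add: entry_def)

text \<open>
  An invertible diagonal matrix times \<open>X\<^sup>a\<close>.  The equivalence also records that the entries on the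
  shifted diagonal do not vanish.
\<close>
definition cyclic_monomial :: "int \<Rightarrow> complex mat \<Rightarrow> bool" where
  "cyclic_monomial a M \<longleftrightarrow>
     M \<in> carrier_mat p p \<and> (\<forall>i j. entry M i j \<noteq> 0 \<longleftrightarrow> [i = j + a] (mod int p))"

lemma cyclic_monomial_carrier: "cyclic_monomial a M \<Longrightarrow> M \<in> carrier_mat p p"
  by (simp add: cyclic_monomial_def)

lemma cyclic_monomial_nonzero: "cyclic_monomial a M \<Longrightarrow> entry M i (i - a) \<noteq> 0"
  by (simp add: cyclic_monomial_def)

lemma cyclic_monomial_cong:
  "cyclic_monomial a M \<Longrightarrow> cyclic_monomial b M \<longleftrightarrow> [a = b] (mod int p)"
proof
  assume "cyclic_monomial a M" "cyclic_monomial b M"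
  then have "[a = 0 + b] (mod int p)"
    unfolding cyclic_monomial_def by (metis add.left_neutral cong_refl)
  then show "[a = b] (mod int p)" by simp
next
  assume M: "cyclic_monomial a M" and ab: "[a = b] (mod int p)"
  have "[i = j + a] (mod int p) \<longleftrightarrow> [i = j + b] (mod int p)" for i j
    using ab by (meson cong_add_lcancel cong_sym cong_trans)
  then show "cyclic_monomial b M" using M unfolding cyclic_monomial_def by blast
qed

lemma entry_mult:
  assumes M: "cyclic_monomial a M" and N: "N \<in> carrier_mat p p"
  shows "entry (M * N) i j = entry M i (i - a) * entry N (i - a) j"
proof -
  let ?k = "nat ((i - a) mod int p)"
  have k: "?k < p" by (rule nat_mod_less)
  have kk: "int ?k = (i - a) mod int p" using p_pos by simp
  have other: "M $$ (nat (i mod int p), l) = 0" if "l < p" "l \<noteq> ?k" for l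
  proof (rule ccontr)
    assume "M $$ (nat (i mod int p), l) \<noteq> 0"
    then have "entry M i (int l) \<noteq> 0" using that by (simp add: entry_def)
    then have "[i = int l + a] (mod int p)" using M by (simp add: cyclic_monomial_def)
    then have "[i - a = int l] (mod int p)" by (metis add_diff_cancel_right' cong_diff cong_refl)
    then have "int l = (i - a) mod int p" using that by (simp add: cong_def)
    then show False using that kk by simp
  qed
  have Mc: "M \<in> carrier_mat p p" using M by (rule cyclic_monomial_carrier)
  have "entry (M * N) i j
      = (\<Sum>l = 0..<p. M $$ (nat (i mod int p), l) * N $$ (l, nat (j mod int p)))"
    using Mc N nat_mod_less by (simp add: entry_def scalar_prod_def)
  also have "\<dots> = (\<Sum>l = 0..<p. if l = ?k then M $$ (nat (i mod int p), ?k) * N $$ (?k, nat (j mod int p)) else 0)"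
    by (rule sum.cong) (auto simp: other)
  also have "\<dots> = entry M i (i - a) * entry N (i - a) j"
    using k by (simp add: entry_def)
  finally show ?thesis .
qed

lemma cyclic_monomial_mult:
  assumes "cyclic_monomial a M" "cyclic_monomial b N"
  shows "cyclic_monomial (a + b) (M * N)"
proof -
  have "entry (M * N) i j \<noteq> 0 \<longleftrightarrow> [i = j + (a + b)] (mod int p)" for i j
  proof -
    have "[i - a = j + b] (mod int p) \<longleftrightarrow> [i = j + (a + b)] (mod int p)"
      by (simp add: cong_iff_dvd_diff algebra_simps)
    then show ?thesis
      using assms entry_mult[OF assms(1) cyclic_monomial_carrier[OF assms(2)]]
      by (auto simp: cyclic_monomial_def)
  qed
  then show ?thesis using assms by (auto simp: cyclic_monomial_def)
qed

lemma cyclic_monomial_smult: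
  "cyclic_monomial a M \<Longrightarrow> s \<noteq> 0 \<Longrightarrow> cyclic_monomial a (s \<cdot>\<^sub>m M)"
  by (auto simp: cyclic_monomial_def entry_smult)

lemma cyclic_monomial_one: "cyclic_monomial 0 (1\<^sub>m p)"
proof -
  have "entry (1\<^sub>m p) i j \<noteq> 0 \<longleftrightarrow> [i = j] (mod int p)" for i j
    using nat_mod_less p_pos by (auto simp: entry_def cong_def eq_nat_nat_iff)
  then show ?thesis by (simp add: cyclic_monomial_def)
qed

section \<open>Conjugation into Weyl operators\<close>

definition commute_up_to :: "complex \<Rightarrow> complex mat \<Rightarrow> complex mat \<Rightarrow> bool" where
  "commute_up_to c M N \<longleftrightarrow> c \<noteq> 0 \<and> M * N = c \<cdot>\<^sub>m (N * M)"

lemma commute_up_to_sym: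
  assumes "commute_up_to c M N" "M \<in> carrier_mat p p" "N \<in> carrier_mat p p"
  shows "commute_up_to (1 / c) N M"
proof -
  have "(1 / c) \<cdot>\<^sub>m (M * N) = (1 / c * c) \<cdot>\<^sub>m (N * M)"
    using assms by (auto simp: commute_up_to_def intro!: eq_matI)
  also have "\<dots> = N * M"
    using assms by (auto simp: commute_up_to_def intro!: eq_matI)
  finally show ?thesis using assms by (simp add: commute_up_to_def)
qed

lemma commute_up_to_refl: "M \<in> carrier_mat p p \<Longrightarrow> commute_up_to 1 M M"
  by (auto simp: commute_up_to_def intro!: eq_matI)

lemma commute_up_to_mult:
  assumes "commute_up_to c M N" "commute_up_to d M K"
    and car: "M \<in> carrier_mat p p" "N \<in> carrier_mat p p" "K \<in> carrier_mat p p"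
  shows "commute_up_to (c * d) M (N * K)"
proof -
  note sm = mult_smult_assoc_mat[of _ p p _ p] mult_smult_distrib[of _ p p _ p] assoc_mult_mat[of _ p p _ p _ p]
  have "M * (N * K) = (M * N) * K" using car by (simp add: sm)
  also have "\<dots> = c \<cdot>\<^sub>m (N * (M * K))" using assms by (simp add: commute_up_to_def sm)
  also have "\<dots> = c \<cdot>\<^sub>m (d \<cdot>\<^sub>m (N * (K * M)))" using assms by (simp add: commute_up_to_def sm)
  also have "\<dots> = (c * d) \<cdot>\<^sub>m ((N * K) * M)" using car by (simp add: sm smult_smult_mat)
  finally show ?thesis using assms by (simp add: commute_up_to_def)
qed

lemma root_of_unity_nonzero: "z ^ p = 1 \<Longrightarrow> z \<noteq> (0 :: complex)"
  using p_pos by (auto simp: power_0_left)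

lemma powi_cong:
  fixes k :: complex
  assumes "k ^ p = 1" "[i = j] (mod int p)"
  shows "k powi i = k powi j"
proof -
  obtain t where t: "i = j + int p * t" using assms(2) by (metis cong_iff_lin cong_sym mult.commute)
  have k: "k \<noteq> 0" using assms(1) by (rule root_of_unity_nonzero)
  have "k powi i = k powi j * (k powi int p) powi t"
    unfolding t using k by (simp add: power_int_add power_int_mult)
  then show ?thesis using assms(1) by simp
qed

text \<open>
  Conjugating \<open>M\<close> with the diagonal matrix of the values of \<open>P\<close> divides row \<open>i\<close> by \<open>P i\<close> and
  multiplies column \<open>j\<close> by \<open>P j\<close>.  The result is the Weyl operator \<open>l Z\<^sup>t X\<^sup>a\<close> if its entries on the
  shifted diagonal form a geometric progression whose ratio \<open>k = \<omega>\<^sup>t\<close> is a \<open>p\<close>-th root of unity.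
\<close>
definition gauge :: "(int \<Rightarrow> complex) \<Rightarrow> int \<Rightarrow> complex mat \<Rightarrow> bool" where
  "gauge P a M \<longleftrightarrow> (\<forall>i. P i \<noteq> 0) \<and> (\<forall>i j. [i = j] (mod int p) \<longrightarrow> P i = P j) \<and>
     (\<exists>l k. k ^ p = 1 \<and> (\<forall>i. entry M i (i - a) * P (i - a) / P i = l * k powi i))"

text \<open>
  For \<open>s\<close> a \<open>p\<close>-th root of the product of all nonzero entries, the recursion
  \<open>P (i) = P (i - a) m (i) / s\<close> closes up after \<open>p\<close> steps, and as \<open>a\<close> is prime to \<open>p\<close> it reaches every
  index exactly once.  So \<open>M\<close> is even conjugate to \<open>s X\<^sup>a\<close>.
\<close>
lemma gauge_exists:
  assumes M: "cyclic_monomial a M" and a: "\<not> int p dvd a"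
  shows "\<exists>P. gauge P a M"
proof -
  define m where "m i = entry M i (i - a)" for i
  have m0: "m i \<noteq> 0" for i using M by (simp add: m_def cyclic_monomial_nonzero)
  have m_cong: "m i = m j" if "[i = j] (mod int p)" for i j
    unfolding m_def by (rule entry_cong) (use that in \<open>auto intro: cong_diff\<close>)
  define d where "d = (\<Prod>l = 1..p. m (int l * a))"
  have d0: "d \<noteq> 0" by (simp add: d_def m0)
  obtain s where s: "s ^ p = d"
  proof
    show "rcis (root p (cmod d)) (Arg d / real p) ^ p = d"
      using p_pos by (simp add: DeMoivre2 rcis_cmod_Arg)
  qed
  have s0: "s \<noteq> 0" using s d0 p_pos by auto
  define F where "F n = (\<Prod>l = 1..n. m (int l * a) / s)" for n :: nat
  have F0: "F n \<noteq> 0" for n by (simp add: F_def m0 s0)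
  have F_Suc: "F (Suc n) = F n * (m (int (Suc n) * a) / s)" for n by (simp add: F_def)
  have F_p: "F p = 1" using d0 s by (simp add: F_def prod_dividef d_def)
  have "coprime a (int p)"
    using a prime_p by (metis coprime_commute prime_imp_coprime prime_nat_int_transfer)
  then obtain b where b: "[a * b = 1] (mod int p)" using cong_solve_coprime_int by blast
  \<comment> \<open>Starting from 0, the index \<open>i\<close> is reached after \<open>i / a\<close> steps of length \<open>a\<close>.\<close>
  define P where "P i = F (nat (i * b mod int p))" for i
  have P_cong: "P i = P j" if "[i = j] (mod int p)" for i j
    using cong_scalar_right[OF that, of b] by (simp add: P_def cong_def)
  have step: "m i * P (i - a) / P i = s" for i
  proof -
    define n where "n = nat ((i - a) * b mod int p)"
    have np: "n < p" unfolding n_def by (rule nat_mod_less)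
    have n: "[int n = (i - a) * b] (mod int p)" using p_pos by (simp add: n_def)
    have "[(i - a) * b + a * b = (i - a) * b + 1] (mod int p)" using b by (simp add: cong_add_lcancel)
    then have "[i * b = int n + 1] (mod int p)"
      using n by (metis (no_types, lifting) cong_add_rcancel cong_sym cong_trans diff_add_cancel distrib_right)
    then have ib: "[i * b = int (Suc n)] (mod int p)" by (simp add: add.commute)
    have "[i * b * a = i * 1] (mod int p)"
      using cong_scalar_left[OF b, of i] by (simp add: ac_simps)
    then have "[int (Suc n) * a = i] (mod int p)"
      using cong_scalar_right[OF ib, of a] by (metis cong_sym cong_trans mult.right_neutral)
    then have mi: "m (int (Suc n) * a) = m i" by (rule m_cong)
    \<comment> \<open>The residue of \<open>i b\<close> is \<open>n + 1\<close> except at the last step, where it wraps around to 0.\<close>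
    have "P i = F (Suc n)"
    proof (cases "Suc n = p")
      case True
      then have "i * b mod int p = 0" using ib by (simp add: cong_def)
      then have "P i = F 0" by (simp add: P_def)
      then show ?thesis using True F_p by (simp add: F_def)
    next
      case False
      then have "Suc n < p" using np by simp
      then have "i * b mod int p = int (Suc n)" using ib by (simp add: cong_def)
      then show ?thesis by (simp add: P_def nat_add_distrib)
    qed
    moreover have "P (i - a) = F n" by (simp add: P_def n_def)
    ultimately show ?thesis using F_Suc[of n] mi F0[of n] m0[of i] s0 by simp
  qed
  have "gauge P a M"
    unfolding gauge_def
  proof (intro conjI exI)
    show "\<forall>i. P i \<noteq> 0" by (simp add: P_def F0)
    show "\<forall>i. entry M i (i - a) * P (i - a) / P i = s * 1 powi i" using step by (simp add: m_def)
  qed (use P_cong in auto)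
  then show ?thesis by blast
qed

text \<open>
  After conjugation \<open>M\<close> is a Weyl operator, and comparing entries in \<open>M N = c N M\<close> shows that going
  \<open>a\<close> steps along the shifted diagonal of \<open>N\<close> multiplies the conjugated entry by a constant factor.  As \<open>a\<close> is
  invertible modulo \<open>p\<close>, so does a single step, and \<open>N\<close> is a Weyl operator as well.
\<close>
lemma gauge_transfer:
  assumes M: "cyclic_monomial a M" and N: "cyclic_monomial b N" and a: "\<not> int p dvd a"
    and comm: "commute_up_to c M N" and P: "gauge P a M"
  shows "gauge P b N"
proof -
  obtain l k where k: "k ^ p = 1"
    and lk: "\<And>i. entry M i (i - a) * P (i - a) / P i = l * k powi i"
    and P0: "\<And>i. P i \<noteq> 0" and P_cong: "\<And>i j. [i = j] (mod int p) \<Longrightarrow> P i = P j"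
    using P unfolding gauge_def by blast
  have k0: "k \<noteq> 0" using k by (rule root_of_unity_nonzero)
  have l0: "l \<noteq> 0" using lk[of 0] P0 cyclic_monomial_nonzero[OF M, of 0] by auto
  define v where "v i = entry N i (i - b) * P (i - b) / P i" for i
  have v_cong: "v i = v j" if "[i = j] (mod int p)" for i j
    using that P_cong[of i j] P_cong[of "i - b" "j - b"] entry_cong[of i j "i - b" "j - b"]
    by (simp add: v_def cong_diff)
  have Mc: "M \<in> carrier_mat p p" and Nc: "N \<in> carrier_mat p p"
    using M N by (auto dest: cyclic_monomial_carrier)
  define q where "q = c * k powi (-b)"
  have v_step: "v (i - a) = q * v i" for i
  proof -
    have "entry (M * N) i (i - a - b) = c * entry (N * M) i (i - a - b)"
      using comm entry_smult[of "N * M"] Mc Nc by (simp add: commute_up_to_def)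
    then have e: "entry M i (i - a) * entry N (i - a) (i - a - b)
        = c * (entry N i (i - b) * entry M (i - b) (i - b - a))"
      using entry_mult[OF M Nc] entry_mult[OF N Mc] by (simp add: algebra_simps)
    have "(l * k powi i) * v (i - a)
        = entry M i (i - a) * entry N (i - a) (i - a - b) * P (i - a - b) / P i"
      using P0 by (simp add: lk[symmetric] v_def)
    also have "\<dots> = c * (entry N i (i - b) * entry M (i - b) (i - b - a)) * P (i - b - a) / P i"
      unfolding e by (simp add: algebra_simps)
    also have "\<dots> = c * v i * (l * k powi (i - b))"
      using P0 by (simp add: lk[symmetric] v_def)
    also have "\<dots> = (l * k powi i) * (q * v i)"
      using k0 by (simp add: q_def power_int_diff power_int_minus field_simps)
    finally show ?thesis using l0 k0 by simp
  qed
  have v_iter: "v (i - int n * a) = q ^ n * v i" for i n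
  proof (induction n)
    case (Suc n)
    have "v (i - int (Suc n) * a) = v ((i - int n * a) - a)" by (simp add: algebra_simps)
    then show ?case using Suc v_step by simp
  qed simp
  have v0: "v i \<noteq> 0" for i using N P0 by (simp add: v_def cyclic_monomial_nonzero)
  have "v (0 - int p * a) = v 0" by (rule v_cong) (simp add: cong_def)
  then have qp: "q ^ p = 1" using v_iter[of 0 p] v0[of 0] by simp
  have "coprime (- a) (int p)"
    using a prime_p by (metis coprime_commute coprime_minus_left_iff prime_imp_coprime prime_nat_int_transfer)
  then obtain z where z: "[(- a) * z = 1] (mod int p)" using cong_solve_coprime_int by blast
  \<comment> \<open>Moving by \<open>- a\<close> exactly \<open>n\<close> times amounts to a single step forward.\<close>
  define n where "n = nat (z mod int p)"
  have "[int n = z] (mod int p)" using p_pos by (simp add: n_def)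
  then have "[(- a) * int n = 1] (mod int p)" using z cong_scalar_left cong_trans by blast
  then have n: "[- (int n * a) = 1] (mod int p)" by (simp add: mult.commute)
  define r where "r = q ^ n"
  have rp: "r ^ p = 1" using qp by (metis r_def power_mult mult.commute power_one)
  have r0: "r \<noteq> 0" using rp by (rule root_of_unity_nonzero)
  have v_next: "v (i + 1) = r * v i" for i
  proof -
    have "[i + - (int n * a) = i + 1] (mod int p)" using n by (simp only: cong_add_lcancel)
    then have "v (i - int n * a) = v (i + 1)" by (intro v_cong) simp
    then show ?thesis using v_iter[of i n] by (simp add: r_def)
  qed
  have "v i = v 0 * r powi i" for i
  proof (induction i rule: int_induct[where k = 0])
    case (step1 i)
    then show ?case using v_next[of i] r0 by (simp add: power_int_add)
  next
    case (step2 i)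
    have "r * v (i - 1) = r * (v 0 * r powi (i - 1))"
      using v_next[of "i - 1"] step2 r0 by (simp add: power_int_diff)
    then show ?case using r0 by simp
  qed simp
  then have "\<forall>i. entry N i (i - b) * P (i - b) / P i = v 0 * r powi i" by (simp add: v_def)
  then show ?thesis
    unfolding gauge_def using P0 P_cong rp by blast
qed

section \<open>A character up to commutators\<close>

text \<open>
  The entry of the conjugated matrix at row \<open>a / 2\<close> and column \<open>- a / 2\<close>, halves being taken modulo
  \<open>p\<close>.  This symmetric position makes the deviation from multiplicativity depend on the commutator
  alone.
\<close>
definition symbol :: "(int \<Rightarrow> complex) \<Rightarrow> int \<Rightarrow> complex mat \<Rightarrow> complex" where
  "symbol P a M = entry M (a * int half) (- (a * int half)) * P (- (a * int half)) / P (a * int half)"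

lemma symbol_gauge:
  assumes "\<And>i j. [i = j] (mod int p) \<Longrightarrow> P i = P j"
    and "\<And>i. entry M i (i - a) * P (i - a) / P i = l * k powi i"
  shows "symbol P a M = l * k powi (a * int half)"
proof -
  have c: "[- (a * int half) = a * int half - a] (mod int p)"
    using half_cong[of a] by (simp add: cong_iff_dvd_diff dvd_diff_commute algebra_simps)
  have "entry M (a * int half) (- (a * int half)) = entry M (a * int half) (a * int half - a)"
    by (rule entry_cong) (use c in auto)
  then show ?thesis using assms(1)[OF c] assms(2)[of "a * int half"] by (simp add: symbol_def)
qed

lemma symbol_cong:
  assumes "\<And>i j. [i = j] (mod int p) \<Longrightarrow> P i = P j" "[a = b] (mod int p)"
  shows "symbol P a M = symbol P b M"
proof -
  have c: "[a * int half = b * int half] (mod int p)" using assms(2) by (rule cong_scalar_right)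
  then have c': "[- (a * int half) = - (b * int half)] (mod int p)" by (simp add: cong_minus_minus_iff)
  show ?thesis unfolding symbol_def
    using assms(1)[OF c] assms(1)[OF c'] entry_cong[OF c c'] by simp
qed

text \<open>
  For Weyl operators \<open>l Z\<^sup>t X\<^sup>a\<close> and \<open>l' Z\<^sup>u X\<^sup>b\<close> the symbols are \<open>l \<omega>\<close> to the power \<open>t a / 2\<close> and
  \<open>l' \<omega>\<close> to the power \<open>u b / 2\<close>, and that of the product is \<open>l l' \<omega>\<close> to the power
  \<open>(t + u) (a + b) / 2 - u a\<close>.  The exponents differ by \<open>(t b - u a) / 2\<close>, half of that of the
  commutator.
\<close>
lemma symbol_mult:
  assumes M: "cyclic_monomial a M" and N: "cyclic_monomial b N"
    and PM: "gauge P a M" and PN: "gauge P b N" and comm: "commute_up_to c M N"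
  shows "symbol P (a + b) (M * N) = symbol P a M * symbol P b N * c ^ half"
proof -
  obtain l k where k: "k ^ p = 1"
    and lk: "\<And>i. entry M i (i - a) * P (i - a) / P i = l * k powi i"
    and P0: "\<And>i. P i \<noteq> 0" and P_cong: "\<And>i j. [i = j] (mod int p) \<Longrightarrow> P i = P j"
    using PM unfolding gauge_def by blast
  obtain l' k' where k': "k' ^ p = 1"
    and lk': "\<And>i. entry N i (i - b) * P (i - b) / P i = l' * k' powi i"
    using PN unfolding gauge_def by blast
  have nz: "k \<noteq> 0" "k' \<noteq> 0"
    using k k' by (auto dest: root_of_unity_nonzero)
  have l0: "l \<noteq> 0" "l' \<noteq> 0"
    using lk[of 0] lk'[of 0] P0 cyclic_monomial_nonzero[OF M, of 0] cyclic_monomial_nonzero[OF N, of 0]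
    by auto
  have Mc: "M \<in> carrier_mat p p" and Nc: "N \<in> carrier_mat p p"
    using M N by (auto dest: cyclic_monomial_carrier)
  have MN: "entry (M * N) i (i - (a + b)) * P (i - (a + b)) / P i
      = (l * k powi i) * (l' * k' powi (i - a))" for i
    using P0 by (simp add: entry_mult[OF M Nc] lk[symmetric] lk'[symmetric] algebra_simps)
  have NM: "entry (N * M) i (i - (a + b)) * P (i - (a + b)) / P i
      = (l' * k' powi i) * (l * k powi (i - b))" for i
    using P0 by (simp add: entry_mult[OF N Mc] lk[symmetric] lk'[symmetric] algebra_simps)
  have "entry (M * N) i j = c * entry (N * M) i j" for i j
    using comm entry_smult[of "N * M"] Mc Nc by (simp add: commute_up_to_def)
  then have "(l * k powi 0) * (l' * k' powi (0 - a)) = c * ((l' * k' powi 0) * (l * k powi (0 - b)))"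
    unfolding MN[symmetric] NM[symmetric] by simp
  then have "k' powi (- a) = c * k powi (- b)" using l0 by (simp add: ac_simps)
  then have c: "c = k powi b * k' powi (- a)"
    using nz by (simp add: power_int_minus field_simps)
  have "symbol P (a + b) (M * N) = (l * l' * k' powi (- a)) * (k * k') powi ((a + b) * int half)"
  proof (rule symbol_gauge[OF P_cong])
    fix i
    show "entry (M * N) i (i - (a + b)) * P (i - (a + b)) / P i
        = l * l' * k' powi (- a) * (k * k') powi i"
      unfolding MN using nz by (simp add: power_int_diff power_int_minus power_int_mult_distrib field_simps)
  qed
  also have "\<dots> = (l * k powi (a * int half)) * (l' * k' powi (b * int half)) *
      (k powi (b * int half) * k' powi (a * int half - a))"
    using nz by (simp add: power_int_mult_distrib power_int_add power_int_diff power_int_minus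
        distrib_right field_simps)
  \<comment> \<open>Here \<open>a / 2 - a = - a / 2\<close> modulo \<open>p\<close>.\<close>
  also have "k' powi (a * int half - a) = k' powi (- (a * int half))"
    by (rule powi_cong[OF k'])
       (use half_cong[of a] in \<open>simp add: cong_iff_dvd_diff dvd_diff_commute algebra_simps\<close>)
  also have "k powi (b * int half) * k' powi (- (a * int half)) = c ^ half"
    unfolding c by (simp add: power_mult_distrib power_int_mult power_int_minus power_inverse)
  finally show ?thesis
    using symbol_gauge[OF P_cong lk] symbol_gauge[OF P_cong lk'] by simp
qed

definition shift :: "complex mat \<Rightarrow> int" where
  "shift M = (SOME a. cyclic_monomial a M)"

text \<open>
  The choice depends on \<open>M\<close> only through the set of its gauges, so matrices with the same gauges get the
  same one.  A diagonal matrix may have no gauge at all; its symbol is the same for every \<open>P\<close>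
  without zeros.
\<close>
definition chosen_gauge :: "complex mat \<Rightarrow> int \<Rightarrow> complex" where
  "chosen_gauge M = (if int p dvd shift M then (\<lambda>_. 1) else (SOME P. gauge P (shift M) M))"

definition weyl_character :: "complex mat \<Rightarrow> complex" where
  "weyl_character M = symbol (chosen_gauge M) (shift M) M"

lemma cyclic_monomial_shift: "cyclic_monomial a M \<Longrightarrow> cyclic_monomial (shift M) M"
  unfolding shift_def by (rule someI)

lemma shift_cong: "cyclic_monomial a M \<Longrightarrow> [shift M = a] (mod int p)"
  using cyclic_monomial_cong cyclic_monomial_shift by blast

lemma chosen_gauge:
  assumes "cyclic_monomial a M" "\<not> int p dvd shift M"
  shows "gauge (chosen_gauge M) (shift M) M"
  unfolding chosen_gauge_def
  using assms gauge_exists[OF cyclic_monomial_shift] someI_ex[of "\<lambda>P. gauge P (shift M) M"] by auto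

lemma symbol_of_diagonal:
  assumes "cyclic_monomial a M" "int p dvd a" "\<And>i. P i \<noteq> 0"
    "\<And>i j. [i = j] (mod int p) \<Longrightarrow> P i = P j"
  shows "symbol P a M = entry M 0 0"
proof -
  have "[a * int half = 0] (mod int p)" "[- (a * int half) = 0] (mod int p)"
    using assms(2) by (auto simp: cong_0_iff)
  then show ?thesis
    using assms(3) assms(4)[of "a * int half" 0] assms(4)[of "- (a * int half)" 0]
      entry_cong[of "a * int half" 0 "- (a * int half)" 0] by (simp add: symbol_def)
qed

text \<open>
  If \<open>N\<close> has nonzero shift, everything that commutes with \<open>N\<close> up to a scalar can be evaluated in the
  gauge of \<open>N\<close>: a matrix of nonzero shift has the same gauges as \<open>N\<close>, hence the same chosen one, and
  for a diagonal matrix the gauge is irrelevant.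
\<close>
lemma weyl_character_eq_symbol:
  assumes N: "cyclic_monomial b N" and b: "\<not> int p dvd b"
    and M: "cyclic_monomial a M" and comm: "commute_up_to c N M"
  shows "gauge (chosen_gauge N) a M" and "weyl_character M = symbol (chosen_gauge N) a M"
proof -
  define P where "P = chosen_gauge N"
  note sN = cyclic_monomial_shift[OF N] and sM = cyclic_monomial_shift[OF M]
  have nd: "\<not> int p dvd shift N" using b shift_cong[OF N] cong_dvd_iff by blast
  have PN: "gauge P (shift N) N" unfolding P_def using N nd by (rule chosen_gauge)
  have PM: "gauge P a M" using gauge_transfer[OF sN M nd comm PN] .
  then show "gauge (chosen_gauge N) a M" by (simp add: P_def)
  have P0: "\<And>i. P i \<noteq> 0" and P_cong: "\<And>i j. [i = j] (mod int p) \<Longrightarrow> P i = P j"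
    using PM unfolding gauge_def by blast+
  have "weyl_character M = symbol P (shift M) M"
  proof (cases "int p dvd shift M")
    case True
    then show ?thesis
      unfolding weyl_character_def
      using symbol_of_diagonal[OF sM True, of P] P0 P_cong
        symbol_of_diagonal[OF sM True, of "chosen_gauge M"] by (simp add: chosen_gauge_def)
  next
    case False
    have comm': "commute_up_to (1 / c) M N"
      using comm M N by (auto intro: commute_up_to_sym cyclic_monomial_carrier)
    have "gauge R (shift N) N \<longleftrightarrow> gauge R (shift M) M" for R
      using gauge_transfer[OF sN sM nd comm] gauge_transfer[OF sM sN False comm'] by blast
    then have "chosen_gauge M = P" unfolding chosen_gauge_def P_def using nd False by simp
    then show ?thesis by (simp add: weyl_character_def)
  qed
  also have "\<dots> = symbol P a M" using P_cong shift_cong[OF M] by (rule symbol_cong)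
  finally show "weyl_character M = symbol (chosen_gauge N) a M" by (simp add: P_def)
qed

lemma weyl_character_of_diagonal:
  assumes "cyclic_monomial a M" "int p dvd a"
  shows "weyl_character M = entry M 0 0"
proof -
  have d: "int p dvd shift M" using assms shift_cong cong_dvd_iff by blast
  show ?thesis unfolding weyl_character_def
    using symbol_of_diagonal[OF cyclic_monomial_shift[OF assms(1)] d] d by (simp add: chosen_gauge_def)
qed

text \<open>
  If one of the two matrices has nonzero shift, its gauge serves both of them and their product; otherwise
  both are diagonal, commute, and the entry at \<open>(0, 0)\<close> is multiplicative.
\<close>
lemma weyl_character_mult:
  assumes M: "cyclic_monomial a M" and N: "cyclic_monomial b N" and comm: "commute_up_to c M N"
  shows "weyl_character (M * N) = weyl_character M * weyl_character N * c ^ half"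
proof -
  note Mc = cyclic_monomial_carrier[OF M] and Nc = cyclic_monomial_carrier[OF N]
  note MN = cyclic_monomial_mult[OF M N]
  have generic: ?thesis if K: "cyclic_monomial d K" "\<not> int p dvd d"
    and KM: "commute_up_to x K M" and KN: "commute_up_to y K N" for d K x y
  proof -
    have "commute_up_to (x * y) K (M * N)"
      using KM KN cyclic_monomial_carrier[OF K(1)] Mc Nc by (rule commute_up_to_mult)
    then have "weyl_character (M * N) = symbol (chosen_gauge K) (a + b) (M * N)"
      using weyl_character_eq_symbol(2)[OF K MN] by blast
    also have "\<dots> = symbol (chosen_gauge K) a M * symbol (chosen_gauge K) b N * c ^ half"
      using symbol_mult[OF M N] weyl_character_eq_symbol(1)[OF K M KM] weyl_character_eq_symbol(1)[OF K N KN] comm by blast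
    finally show ?thesis
      using weyl_character_eq_symbol(2)[OF K M KM] weyl_character_eq_symbol(2)[OF K N KN] by simp
  qed
  consider "\<not> int p dvd a" | "\<not> int p dvd b" | "int p dvd a" "int p dvd b" by blast
  then show ?thesis
  proof cases
    case 1
    then show ?thesis using generic[OF M] commute_up_to_refl[OF Mc] comm by blast
  next
    case 2
    then show ?thesis
      using generic[OF N] commute_up_to_refl[OF Nc] commute_up_to_sym[OF comm Mc Nc] by blast
  next
    case 3
    have e: "entry M 0 (- a) = entry M 0 0" "entry M (- b) 0 = entry M 0 0"
      "entry N (- a) 0 = entry N 0 0" "entry N 0 (- b) = entry N 0 0"
      using 3 by (auto intro!: entry_cong simp: cong_0_iff)
    have "entry (M * N) 0 0 = c * entry (N * M) 0 0"
      using comm entry_smult[of "N * M"] Mc Nc by (simp add: commute_up_to_def)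
    then have eq: "entry M 0 0 * entry N 0 0 = c * (entry N 0 0 * entry M 0 0)"
      using entry_mult[OF M Nc, of 0 0] entry_mult[OF N Mc, of 0 0] e by simp
    have "entry M 0 0 \<noteq> 0" "entry N 0 0 \<noteq> 0"
      using cyclic_monomial_nonzero[OF M, of 0] cyclic_monomial_nonzero[OF N, of 0] e by auto
    then have "c = 1" using eq by simp
    then show ?thesis
      using weyl_character_of_diagonal[OF M] weyl_character_of_diagonal[OF N] weyl_character_of_diagonal[OF MN] 3
        entry_mult[OF M Nc, of 0 0] e by simp
  qed
qed

lemma weyl_character_nonzero:
  assumes M: "cyclic_monomial a M"
  shows "weyl_character M \<noteq> 0"
proof -
  have "chosen_gauge M i \<noteq> 0" for i
    using chosen_gauge[OF M] by (cases "int p dvd shift M") (auto simp: chosen_gauge_def gauge_def)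
  moreover have "[shift M * int half = - (shift M * int half) + shift M] (mod int p)"
    using half_cong[of "shift M"] by (simp add: cong_iff_dvd_diff algebra_simps)
  then have "entry M (shift M * int half) (- (shift M * int half)) \<noteq> 0"
    using cyclic_monomial_shift[OF M] by (simp add: cyclic_monomial_def)
  ultimately show ?thesis by (simp add: weyl_character_def symbol_def)
qed

text \<open>
  Scalar matrices commute with everything, so this is a special case of the product formula.
\<close>
lemma weyl_character_smult:
  assumes M: "cyclic_monomial a M" and s: "s \<noteq> 0"
  shows "weyl_character (s \<cdot>\<^sub>m M) = s * weyl_character M"
proof -
  have S: "cyclic_monomial 0 (s \<cdot>\<^sub>m 1\<^sub>m p)" using cyclic_monomial_one s by (rule cyclic_monomial_smult)
  note Mc = cyclic_monomial_carrier[OF M]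
  have "(s \<cdot>\<^sub>m 1\<^sub>m p) * M = s \<cdot>\<^sub>m M" "M * (s \<cdot>\<^sub>m 1\<^sub>m p) = s \<cdot>\<^sub>m M"
    using Mc mult_smult_assoc_mat[of "1\<^sub>m p" p p M p] mult_smult_distrib[of M p p "1\<^sub>m p" p] by auto
  moreover from this have "commute_up_to 1 (s \<cdot>\<^sub>m 1\<^sub>m p) M"
    by (auto simp: commute_up_to_def intro!: eq_matI)
  ultimately have "weyl_character (s \<cdot>\<^sub>m M) = weyl_character (s \<cdot>\<^sub>m 1\<^sub>m p) * weyl_character M"
    using weyl_character_mult[OF S M] by fastforce
  moreover have "weyl_character (s \<cdot>\<^sub>m 1\<^sub>m p) = s"
    using weyl_character_of_diagonal[OF S] p_pos by (simp add: entry_def)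
  ultimately show ?thesis by simp
qed


section \<open>Tensor products\<close>

definition monomial :: "complex mat \<Rightarrow> bool" where
  "monomial M \<longleftrightarrow> (\<exists>a. cyclic_monomial a M)"

lemma monomial_carrier: "monomial M \<Longrightarrow> M \<in> carrier_mat p p"
  by (auto simp: monomial_def dest: cyclic_monomial_carrier)

lemma monomial_mult: "monomial M \<Longrightarrow> monomial N \<Longrightarrow> monomial (M * N)"
  unfolding monomial_def using cyclic_monomial_mult by blast

lemma monomial_nonzero: "monomial M \<Longrightarrow> M \<noteq> 0\<^sub>m p p"
proof
  assume "monomial M" and z: "M = 0\<^sub>m p p"
  then obtain a where "entry M 0 (0 - a) \<noteq> 0"
    unfolding monomial_def using cyclic_monomial_nonzero by blast
  then show False using nat_mod_less[of "- a"] by (simp add: z entry_def)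
qed

lemma tensor_list_nonzero:
  "\<forall>M\<in>set Ms. monomial M \<Longrightarrow> tensor_list Ms \<noteq> 0\<^sub>m (p ^ length Ms) (p ^ length Ms)"
proof (induction Ms)
  case Nil
  have "tensor_list [] $$ (0, 0) = 1" by (simp add: tensor_list_def)
  then show ?case by auto
next
  case (Cons M Ms)
  then have "kronecker M (tensor_list Ms) \<noteq> 0\<^sub>m (p * p ^ length Ms) (p * p ^ length Ms)"
    by (intro kronecker_nonzero monomial_carrier tensor_list_carrier monomial_nonzero)
      (auto intro: monomial_carrier)
  then show ?case by (simp add: tensor_list_def)
qed

definition tensor_character :: "complex mat list \<Rightarrow> complex" where
  "tensor_character Ms = prod_list (map weyl_character Ms)"

text \<open>
  With \<open>s = 1\<close> this says that the character depends on the tensor product only; the scalar is there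
  because splitting off a factor changes it.
\<close>
lemma tensor_character_smult:
  assumes "length Ms = length Ns" "\<forall>M\<in>set Ms. monomial M" "\<forall>N\<in>set Ns. monomial N"
    and "s \<noteq> 0" "tensor_list Ms = s \<cdot>\<^sub>m tensor_list Ns"
  shows "tensor_character Ms = s * tensor_character Ns"
  using assms
proof (induction Ms Ns arbitrary: s rule: list_induct2)
  case Nil
  then have "(1\<^sub>m 1 :: complex mat) $$ (0, 0) = (s \<cdot>\<^sub>m 1\<^sub>m 1) $$ (0, 0)" by (simp add: tensor_list_def)
  then show ?case by (simp add: tensor_character_def)
next
  case (Cons M Ms N Ns)
  have car: "tensor_list Ms \<in> carrier_mat (p ^ length Ms) (p ^ length Ms)"
    "tensor_list Ns \<in> carrier_mat (p ^ length Ms) (p ^ length Ms)"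
    using Cons tensor_list_carrier[of Ms p] tensor_list_carrier[of Ns p] by (auto dest: monomial_carrier)
  obtain c where c: "c \<noteq> 0" "M = c \<cdot>\<^sub>m N" "tensor_list Ms = (s / c) \<cdot>\<^sub>m tensor_list Ns"
    using kronecker_eq_smultE[of M p N "tensor_list Ms" "p ^ length Ms" "tensor_list Ns" s]
      Cons.prems car monomial_nonzero[of M] monomial_carrier[of M] monomial_carrier[of N]
      tensor_list_nonzero[of Ms] by (auto simp: tensor_list_def)
  have "tensor_character Ms = (s / c) * tensor_character Ns"
    using Cons.prems c by (intro Cons.IH) auto
  moreover have "weyl_character M = c * weyl_character N"
    using Cons.prems c by (auto simp: monomial_def weyl_character_smult)
  ultimately show ?case using c by (simp add: tensor_character_def)
qed

text \<open>
  The scalar \<open>s\<close> is the product of the scalars up to which the factors commute, and so collects all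
  their corrections in a single power.
\<close>
lemma tensor_character_mult:
  assumes "length Ms = length Ns" "\<forall>M\<in>set Ms. monomial M" "\<forall>N\<in>set Ns. monomial N"
    and "s \<noteq> 0" "tensor_list Ms * tensor_list Ns = s \<cdot>\<^sub>m (tensor_list Ns * tensor_list Ms)"
  shows "tensor_character (map2 (*) Ms Ns) = tensor_character Ms * tensor_character Ns * s ^ half"
  using assms
proof (induction Ms Ns arbitrary: s rule: list_induct2)
  case Nil
  then have "(1\<^sub>m 1 * 1\<^sub>m 1 :: complex mat) $$ (0, 0) = (s \<cdot>\<^sub>m (1\<^sub>m 1 * 1\<^sub>m 1)) $$ (0, 0)"
    by (simp add: tensor_list_def)
  then show ?case by (simp add: tensor_character_def)
next
  case (Cons M Ms N Ns)
  let ?q = "p ^ length Ms"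
  note mono = monomial_carrier[of M] monomial_carrier[of N]
  have car: "tensor_list Ms \<in> carrier_mat ?q ?q" "tensor_list Ns \<in> carrier_mat ?q ?q"
    using Cons tensor_list_carrier[of Ms p] tensor_list_carrier[of Ns p] by (auto dest: monomial_carrier)
  have prod: "tensor_list Ms * tensor_list Ns = tensor_list (map2 (*) Ms Ns)"
    using Cons by (intro tensor_list_mult[of _ _ p]) (auto dest: monomial_carrier)
  have "\<forall>K\<in>set (map2 (*) Ms Ns). monomial K"
    using Cons.prems by (auto intro!: monomial_mult elim!: in_set_zipE)
  then have nz: "tensor_list Ms * tensor_list Ns \<noteq> 0\<^sub>m ?q ?q"
    using tensor_list_nonzero[of "map2 (*) Ms Ns"] Cons.hyps prod by simp
  have "kronecker (M * N) (tensor_list Ms * tensor_list Ns)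
      = s \<cdot>\<^sub>m kronecker (N * M) (tensor_list Ns * tensor_list Ms)"
    using Cons.prems mono car
    by (simp add: tensor_list_def kronecker_mult[symmetric, of _ p _ _ ?q])
  then obtain c where c: "c \<noteq> 0" "M * N = c \<cdot>\<^sub>m (N * M)"
    "tensor_list Ms * tensor_list Ns = (s / c) \<cdot>\<^sub>m (tensor_list Ns * tensor_list Ms)"
    using kronecker_eq_smultE[of "M * N" p "N * M" "tensor_list Ms * tensor_list Ns" ?q
        "tensor_list Ns * tensor_list Ms" s]
      Cons.prems car mono nz monomial_nonzero[OF monomial_mult, of M N] by auto
  have "tensor_character (map2 (*) Ms Ns) = tensor_character Ms * tensor_character Ns * (s / c) ^ half"
    using Cons.prems c by (intro Cons.IH) auto
  moreover have "weyl_character (M * N) = weyl_character M * weyl_character N * c ^ half"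
    using Cons.prems c weyl_character_mult by (auto simp: monomial_def commute_up_to_def)
  ultimately show ?case using c by (simp add: tensor_character_def power_divide)
qed

lemma tensor_character_nonzero: "\<forall>M\<in>set Ms. monomial M \<Longrightarrow> tensor_character Ms \<noteq> 0"
  by (induction Ms) (auto simp: tensor_character_def monomial_def weyl_character_nonzero)

section \<open>The character on n-fold tensor products\<close>

lemma entry_adjoint:
  assumes "M \<in> carrier_mat p p"
  shows "entry (mat_adjoint M) i j = cnj (entry M j i)"
  using mat_adjoint_index(2)[OF assms] nat_mod_less by (simp add: entry_def)

lemma monomial_adjoint:
  assumes "monomial M"
  shows "monomial (mat_adjoint M)"
proof -
  obtain a where a: "cyclic_monomial a M" using assms by (auto simp: monomial_def)
  note Mc = cyclic_monomial_carrier[OF a]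
  have "[j = i + a] (mod int p) \<longleftrightarrow> [i = j + - a] (mod int p)" for i j
    by (simp add: cong_iff_dvd_diff dvd_diff_commute algebra_simps)
  then have "cyclic_monomial (- a) (mat_adjoint M)"
    using a mat_adjoint_index(1)[OF Mc] by (simp add: cyclic_monomial_def entry_adjoint[OF Mc])
  then show ?thesis by (auto simp: monomial_def)
qed

lemma inv_special_unitary:
  assumes "U \<in> carrier (special_unitary p)"
  shows "inv\<^bsub>special_unitary p\<^esub> U = mat_adjoint U"
proof -
  interpret group "special_unitary p" by (rule group_special_unitary)
  let ?V = "inv\<^bsub>special_unitary p\<^esub> U"
  have U: "U \<in> carrier_mat p p" "mat_adjoint U * U = 1\<^sub>m p"
    using assms by (auto simp: special_unitary_def)
  have V: "?V \<in> carrier_mat p p" "U * ?V = 1\<^sub>m p"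
    using inv_closed[OF assms] r_inv[OF assms] by (auto simp: special_unitary_def)
  note A = mat_adjoint_index(1)[OF U(1)]
  have "mat_adjoint U = mat_adjoint U * (U * ?V)" using V A by simp
  also have "\<dots> = (mat_adjoint U * U) * ?V" using assoc_mult_mat[OF A U(1) V(1)] by simp
  also have "\<dots> = ?V" using U V by simp
  finally show ?thesis by simp
qed

lemma monomial_shift_mat: "monomial (shift_mat p)"
proof -
  have "entry (shift_mat p) i j \<noteq> 0 \<longleftrightarrow> [i = j + 1] (mod int p)" for i j
  proof -
    have "int ((nat (j mod int p) + 1) mod p) = (j + 1) mod int p"
      using p_pos by (simp add: zmod_int mod_simps add.commute)
    then have "nat (i mod int p) = (nat (j mod int p) + 1) mod p \<longleftrightarrow> i mod int p = (j + 1) mod int p"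
      unfolding of_nat_eq_iff[where 'a = int, symmetric] using p_pos by simp
    then show ?thesis
      using nat_mod_less by (simp add: entry_def shift_mat_def cong_def)
  qed
  then have "cyclic_monomial 1 (shift_mat p)" by (simp add: cyclic_monomial_def shift_mat_def)
  then show ?thesis by (auto simp: monomial_def)
qed

text \<open>
  A vanishing diagonal entry of a diagonal matrix would produce a zero column, which unitarity excludes.
\<close>
lemma monomial_diagonal_torus:
  assumes "t \<in> diagonal_torus p"
  shows "monomial t"
proof -
  have t: "t \<in> carrier_mat p p" "mat_adjoint t * t = 1\<^sub>m p" "diagonal_mat t"
    using assms by (auto simp: diagonal_torus_def special_unitary_def)
  have off: "t $$ (i, j) = 0" if "i < p" "j < p" "i \<noteq> j" for i j
    using t that by (auto simp: diagonal_mat_def)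
  have diag: "t $$ (i, i) \<noteq> 0" if "i < p" for i
  proof
    assume z: "t $$ (i, i) = 0"
    have "(mat_adjoint t * t) $$ (i, i) = (\<Sum>l = 0..<p. mat_adjoint t $$ (i, l) * t $$ (l, i))"
      using t(1) that mat_adjoint_index(1)[OF t(1)] by (auto simp: scalar_prod_def)
    also have "\<dots> = 0" using off z that by (intro sum.neutral) (metis atLeastLessThan_iff mult_zero_right)
    finally show False using t(2) that by simp
  qed
  have "entry t i j \<noteq> 0 \<longleftrightarrow> [i = j] (mod int p)" for i j
    using off[OF nat_mod_less nat_mod_less, of i j] diag[OF nat_mod_less, of i] p_pos
    by (auto simp: entry_def cong_def eq_nat_nat_iff)
  then have "cyclic_monomial 0 t" using t by (simp add: cyclic_monomial_def)
  then show ?thesis by (auto simp: monomial_def)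
qed

lemma E1_monomial:
  assumes "M \<in> E1 p m"
  shows "monomial M"
proof -
  let ?S = "torus_torsion p (p ^ m) \<union> {shift_mat p}"
  have gen: "monomial h" "h \<in> carrier (special_unitary p)" if "h \<in> ?S" for h
    using that monomial_diagonal_torus monomial_shift_mat shift_mat_special_unitary[OF odd_p]
    by (auto simp: torus_torsion_def diagonal_torus_def)
  from assms show ?thesis
    unfolding E1_def
  proof (induction rule: generate.induct)
    case one
    show ?case using cyclic_monomial_one by (auto simp: monomial_def special_unitary_def)
  next
    case (incl h)
    then show ?case by (rule gen(1))
  next
    case (inv h)
    then show ?case using gen inv_special_unitary monomial_adjoint by simp
  next
    case (eng g h)
    then show ?case using monomial_mult by (simp add: special_unitary_def)
  qed
qed

definition E_character :: "nat \<Rightarrow> nat \<Rightarrow> complex mat \<Rightarrow> complex" where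
  "E_character n m U = tensor_character (SOME Ms. length Ms = n \<and> set Ms \<subseteq> E1 p m \<and> tensor_list Ms = U)"

text \<open>
  The \<open>N\<^sub>i\<close> range over all monomial matrices, so that \<open>N\<^sub>i\<close> may be the product of two factors as it
  arises from multiplying tensors, and \<open>s\<close> may be the scalar of the distinguished central element.
\<close>
lemma E_character_smult_tensor_list:
  assumes Ms: "length Ms = n" "set Ms \<subseteq> E1 p m" and Ns: "length Ns = n" "\<forall>N\<in>set Ns. monomial N"
    and eq: "tensor_list Ms = s \<cdot>\<^sub>m tensor_list Ns" and s: "s \<noteq> 0"
  shows "E_character n m (tensor_list Ms) = s * tensor_character Ns"
proof -
  let ?Q = "\<lambda>Ks. length Ks = n \<and> set Ks \<subseteq> E1 p m \<and> tensor_list Ks = tensor_list Ms"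
  define Ks where "Ks = (SOME Ks. ?Q Ks)"
  have "?Q Ms" using Ms by simp
  then have "?Q Ks" unfolding Ks_def by (rule someI)
  then have "tensor_character Ks = s * tensor_character Ns"
    using Ns eq s by (intro tensor_character_smult) (auto dest: E1_monomial)
  then show ?thesis by (simp add: E_character_def Ks_def)
qed

lemma E_character_tensor_list:
  assumes "length Ms = n" "set Ms \<subseteq> E1 p m"
  shows "E_character n m (tensor_list Ms) = tensor_character Ms"
  using E_character_smult_tensor_list[of Ms n m Ms 1] assms E1_monomial by (auto simp: one_smult_mat)

lemma E_character_mult:
  assumes U: "U \<in> carrier (E_group n p m)" and V: "V \<in> carrier (E_group n p m)"
    and comm: "U * V = V * U"
  shows "E_character n m (U * V) = E_character n m U * E_character n m V"
proof -
  obtain Ms Ns where Ms: "U = tensor_list Ms" "length Ms = n" "set Ms \<subseteq> E1 p m"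
    and Ns: "V = tensor_list Ns" "length Ns = n" "set Ns \<subseteq> E1 p m"
    using U V by (auto simp: E_group_def)
  have mono: "\<forall>M\<in>set Ms. monomial M" "\<forall>N\<in>set Ns. monomial N"
    using Ms Ns E1_monomial by auto
  have UV: "U * V = tensor_list (map2 (*) Ms Ns)"
    unfolding Ms(1) Ns(1) using Ms Ns mono by (intro tensor_list_mult[of _ _ p]) (auto dest: monomial_carrier)
  have "U * V \<in> carrier (E_group n p m)"
    using group.is_monoid[OF group_E_group[OF odd_p]] U V monoid.m_closed[of "E_group n p m" U V]
    by (simp add: E_group_def)
  then obtain Ks where Ks: "U * V = tensor_list Ks" "length Ks = n" "set Ks \<subseteq> E1 p m"
    by (auto simp: E_group_def)
  have "\<forall>K\<in>set (map2 (*) Ms Ns). monomial K"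
    using mono by (auto intro!: monomial_mult elim!: in_set_zipE)
  then have "E_character n m (U * V) = 1 * tensor_character (map2 (*) Ms Ns)"
    unfolding Ks(1) using Ks UV Ms Ns by (intro E_character_smult_tensor_list) auto
  also have "\<dots> = tensor_character Ms * tensor_character Ns"
    using tensor_character_mult[of Ms Ns 1] comm Ms Ns mono by (auto simp: one_smult_mat)
  finally show ?thesis
    using Ms Ns by (simp add: E_character_tensor_list)
qed

lemma E_character_one: "E_character n m (1\<^sub>m (p ^ n)) = 1"
proof -
  have one: "1\<^sub>m (p ^ n) \<in> carrier (E_group n p m)"
    using monoid.one_closed[OF group.is_monoid[OF group_E_group[OF odd_p]], of n m]
    by (simp add: E_group_def)
  then obtain Ms where Ms: "1\<^sub>m (p ^ n) = tensor_list Ms" "length Ms = n" "set Ms \<subseteq> E1 p m"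
    by (auto simp: E_group_def)
  have "E_character n m (1\<^sub>m (p ^ n)) \<noteq> 0"
    unfolding Ms(1) using Ms E1_monomial by (auto simp: E_character_tensor_list intro!: tensor_character_nonzero)
  moreover have "E_character n m (1\<^sub>m (p ^ n)) = E_character n m (1\<^sub>m (p ^ n)) * E_character n m (1\<^sub>m (p ^ n))"
    using E_character_mult[OF one one] by simp
  ultimately show ?thesis by simp
qed

lemma E_character_center:
  assumes "n \<ge> 1" "m \<ge> 1"
  shows "E_character n m (E_center n p) = cis (2 * pi / real p)"
proof -
  obtain Ms where Ms: "E_center n p = tensor_list Ms" "length Ms = n" "set Ms \<subseteq> E1 p m"
    using E_center_in_E_group[OF p_pos assms] by (auto simp: E_group_def)
  have "1\<^sub>m (p ^ n) \<in> carrier (E_group n p m)"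
    using monoid.one_closed[OF group.is_monoid[OF group_E_group[OF odd_p]], of n m]
    by (simp add: E_group_def)
  then obtain Ns where Ns: "1\<^sub>m (p ^ n) = tensor_list Ns" "length Ns = n" "set Ns \<subseteq> E1 p m"
    by (auto simp: E_group_def)
  have "E_character n m (E_center n p) = cis (2 * pi / real p) * tensor_character Ns"
    unfolding Ms(1) using Ms Ns E1_monomial
    by (intro E_character_smult_tensor_list) (auto simp: E_center_def)
  also have "tensor_character Ns = 1"
    using E_character_one[of n m] Ns by (simp add: E_character_tensor_list)
  finally show ?thesis by simp
qed

end

theorem corollary4p13:
  fixes p n m r c :: nat and A :: "int mat" and b :: "int vec"
  assumes "prime p" and "odd p" and "n \<ge> 1" and "m \<ge> 1"
    and "linear_system p r c A b"
    and "\<exists>T. system_solution p (E_group n p m) (E_center n p) A b T"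
  shows "\<exists>x. system_solution p (integer_mod_group p) 1 A b x"
proof -
  interpret odd_prime p using assms by unfold_locales
  interpret commuting_character "E_group n p m" "E_character n m"
  proof (intro commuting_character.intro commuting_character_axioms.intro)
    show "group (E_group n p m)" by (rule group_E_group[OF odd_p])
    show "E_character n m (\<one>\<^bsub>E_group n p m\<^esub>) = 1"
      using E_character_one by (simp add: E_group_def)
    show "E_character n m (U \<otimes>\<^bsub>E_group n p m\<^esub> V) = E_character n m U * E_character n m V"
      if "U \<in> carrier (E_group n p m)" "V \<in> carrier (E_group n p m)"
        "U \<otimes>\<^bsub>E_group n p m\<^esub> V = V \<otimes>\<^bsub>E_group n p m\<^esub> U" for U V
      using that E_character_mult[of U n m V] by (simp add: E_group_def)
  qed
  obtain T where "system_solution p (E_group n p m) (E_center n p) A b T" using assms by blast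
  with assms p_pos show ?thesis
    using E_center_in_E_group E_character_center by (intro solution_mod_p[of p "E_center n p"]) auto
qed

end
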